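(* Assume (A1) and (S1) (listed in the context), and let $\mathcal U$ be one of the sets given by (S1), with corresponding component $U(\omega)=\{x\in\mathbb R^n:\tau_x\omega\in\mathcal U\}$, an unbounded connected component of $\{x: a(x,\omega)>0\}$. For $\mu>0$ and $z\in U(\omega)$, let $m_\mu(\cdot,z,\omega)$ be the maximal subsolution of the metric problem in $U(\omega)$ and let $\overline H$ be the effective Hamiltonian corresponding to $\mathcal U$ (both defined in the context). Then, for each $p\in\mathbb R^n$ and each $\omega$ in an event $\overline\Omega$ of full probability, $$\mu\ge\overline H(p)\quad\text{if and only if}\quad\liminf_{\substack{|y|\to\infty\\ y\in U(\omega)}}\frac{m_\mu(y,z,\omega)-p\cdot(y-z)}{|y|}\ge0.$$
   Context: Random setting. $(\Omega,\mathcal F,\mathbb P)$ is a probability space with an ergodic group of measure preserving transformations $(\tau_z)_{z\in\mathbb R^n}$, $\tau_z:\Omega\to\Omega$: $\tau_{z+z'}=\tau_z\circ\tau_{z'}$, $\mathbb P[\tau_z\mathcal V]=\mathbb P[\mathcal V]$ for all $\mathcal V\in\mathcal F$, and if $\tau_z(\mathcal V)=\mathcal V$ for every $z\in\mathbb R^n$ then $\mathbb P[\mathcal V]\in\{0,1\}$. The function $a:\mathbb R^n\times\Omega\to\mathbb R$ is measurable with respect to the $\sigma$-algebra generated by $\mathcal B\times\mathcal F$ ($\mathcal B$ the Borel $\sigma$-algebra of $\mathbb R^n$) and continuous in its first variable for each $\omega$. (A1) $a(y,\tau_z\omega)=a(y+z,\omega)$ for all $y,z\in\mathbb R^n$, $\omega\in\Omega$.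 Components. $(U_i(\omega))_{i\in I^+}$ are the connected components of $\{a(\cdot,\omega)>0\}$ and $(U_i(\omega))_{i\in I^-}$ those of $\{a(\cdot,\omega)<0\}$, with $\partial U_i(\omega)\subset U_0(\omega):=\{x: a(x,\omega)=0\}$; $I:=I^+\cup I^-$, $I_0:=I\cup\{0\}$. (S1) There are measurable sets $\mathcal U_i\subset\Omega$, $i\in I_0$, with $\mathbb P[\mathcal U_0]=\theta_0\ge0$, $\mathbb P[\mathcal U_i]=\theta_i>0$ for $i\in I$, and $U_i(\omega)=\{x\in\mathbb R^n:\tau_x\omega\in\mathcal U_i\}$ for each $\omega$. Metric problem. $U(\omega)=U_i(\omega)$ is a fixed unbounded component with $i\in I^+$, $\mathcal U=\mathcal U_i$, and $U^\delta(\omega):=\{x\in U(\omega):|a(x,\omega)|>\delta\}$ for $\delta>0$. The metric problem is $a(y,\omega)|Dm_\mu|=\mu$ in $U(\omega)\setminus\{z\}$, $m_\mu(z,z,\omega)=0$. $\mathcal L$ is the class of Lipschitz functions on $\mathbb R^n$. For $\mu>0$, $\mathcal S_\mu(U(\omega))$ is the class of functions $w$ such that for each $\eta>0$ sufficiently small there exists $\overline\delta=\overline\delta(\eta)>0$, independent of $\omega$, with $\lim_{\eta\to0}\overline\delta(\eta)=0$ and $|w(y_1)-w(y_2)|\le(\mu/\delta+\eta)|y_1-y_2|$ for all $\delta\in(0,\overline\delta)$ and $y_1,y_2\in U^\delta(\omega)$; $\mathcal L_\mu(U(\omega)):=\mathcal L\cap\mathcal S_\mu(U(\omega))$. For $y,z\in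 U(\omega)$, $m_\mu(y,z,\omega):=\sup\{w(y,\omega):w(\cdot,\omega)\in\mathcal L_\mu(U(\omega)),\ w(z,\omega)=0,\ a(\cdot,\omega)|Dw|\le\mu\text{ in }U(\omega)\}$, differential inequalities being understood in the viscosity sense (equivalently a.e.). Effective Hamiltonian. $\mathcal S^+:=\{w\in\mathcal L:\liminf_{|y|\to\infty}w(y)/|y|\ge0\}$ and $$\overline H(p)=\inf\{\mu>0:\exists\,w(\cdot,\omega)\in\mathcal S^+\text{ with }w(\cdot,\omega)+p\cdot y\in\mathcal L_\mu(U(\omega))\text{ and }a(y,\omega)|p+Dw|\le\mu\text{ in }U(\omega)\},$$ which takes the same value for a.e. $\omega$. *)

theory Defs
  imports "HOL-Probability.Probability"
begin

section \<open>The random medium\<close>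

definition ergodic_flow :: "'w measure \<Rightarrow> (real ^ 'n \<Rightarrow> 'w \<Rightarrow> 'w) \<Rightarrow> bool" where
  "ergodic_flow M \<tau> \<longleftrightarrow>
     (\<forall>z. \<tau> z \<in> space M \<rightarrow> space M) \<and>
     (\<forall>\<omega>\<in>space M. \<tau> 0 \<omega> = \<omega>) \<and>
     (\<forall>z z'. \<forall>\<omega>\<in>space M. \<tau> (z + z') \<omega> = \<tau> z (\<tau> z' \<omega>)) \<and>
     (\<forall>z. \<forall>V\<in>sets M. \<tau> z ` V \<in> sets M \<and> measure M (\<tau> z ` V) = measure M V) \<and>
     (\<forall>V\<in>sets M. (\<forall>z. \<tau> z ` V = V) \<longrightarrow> measure M V \<in> {0, 1})"

definition random_coefficient :: "'w measure \<Rightarrow> (real ^ 'n \<Rightarrow> 'w \<Rightarrow> real) \<Rightarrow> bool" where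
  "random_coefficient M a \<longleftrightarrow>
     (\<lambda>(y, \<omega>). a y \<omega>) \<in> borel_measurable (borel \<Otimes>\<^sub>M M) \<and>
     (\<forall>\<omega>\<in>space M. continuous_on UNIV (\<lambda>y. a y \<omega>))"

definition stationary_coefficient ::
    "'w measure \<Rightarrow> (real ^ 'n \<Rightarrow> 'w \<Rightarrow> 'w) \<Rightarrow> (real ^ 'n \<Rightarrow> 'w \<Rightarrow> real) \<Rightarrow> bool" where
  "stationary_coefficient M \<tau> a \<longleftrightarrow> (\<forall>y z. \<forall>\<omega>\<in>space M. a y (\<tau> z \<omega>) = a (y + z) \<omega>)"

definition region :: "(real ^ 'n \<Rightarrow> 'w \<Rightarrow> 'w) \<Rightarrow> 'w set \<Rightarrow> 'w \<Rightarrow> (real ^ 'n) set" where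
  "region \<tau> V \<omega> = {x. \<tau> x \<omega> \<in> V}"

text \<open>
  The index \<open>0\<close> of the zero set is kept apart from the indices \<open>Ipos\<close>, \<open>Ineg\<close> of the components
  of the positivity and the negativity set, hence the separate argument \<open>V0\<close>.  The
  bijections say that, for every \<open>\<omega>\<close>, the regions enumerate the components without repetition.
\<close>

definition stationary_components ::
    "'w measure \<Rightarrow> (real ^ 'n \<Rightarrow> 'w \<Rightarrow> 'w) \<Rightarrow> (real ^ 'n \<Rightarrow> 'w \<Rightarrow> real) \<Rightarrow>
     'i set \<Rightarrow> 'i set \<Rightarrow> ('i \<Rightarrow> 'w set) \<Rightarrow> 'w set \<Rightarrow> bool" where
  "stationary_components M \<tau> a Ipos Ineg V V0 \<longleftrightarrow>
     V0 \<in> sets M \<and>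
     (\<forall>i\<in>Ipos \<union> Ineg. V i \<in> sets M \<and> measure M (V i) > 0) \<and>
     (\<forall>\<omega>\<in>space M.
        region \<tau> V0 \<omega> = {x. a x \<omega> = 0} \<and>
        bij_betw (\<lambda>i. region \<tau> (V i) \<omega>) Ipos (components {x. a x \<omega> > 0}) \<and>
        bij_betw (\<lambda>i. region \<tau> (V i) \<omega>) Ineg (components {x. a x \<omega> < 0}) \<and>
        (\<forall>i\<in>Ipos \<union> Ineg. frontier (region \<tau> (V i) \<omega>) \<subseteq> region \<tau> V0 \<omega>))"

section \<open>The metric problem for one realisation\<close>

text \<open>
  Below, \<open>A\<close> stands for \<open>a(\<cdot>, \<omega>)\<close> and \<open>U\<close> for \<open>U(\<omega>)\<close>, with \<open>\<omega>\<close> fixed.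
  Viscosity inequality \<open>A |p + Dw| \<le> \<mu>\<close> in the open set \<open>U\<close>; the test function \<open>\<phi>\<close> is \<open>C\<^sup>1\<close> on \<open>U\<close>
  with gradient \<open>g\<close>.
\<close>

definition viscosity_subsol ::
    "(real ^ 'n \<Rightarrow> real) \<Rightarrow> (real ^ 'n) set \<Rightarrow> real ^ 'n \<Rightarrow> real \<Rightarrow> (real ^ 'n \<Rightarrow> real) \<Rightarrow> bool" where
  "viscosity_subsol A U p \<mu> w \<longleftrightarrow>
     (\<forall>\<phi> g. \<forall>x\<in>U.
        (\<forall>y\<in>U. (\<phi> has_derivative (\<lambda>h. g y \<bullet> h)) (at y)) \<and> continuous_on U g \<and>
        (\<forall>\<^sub>F y in nhds x. w y - \<phi> y \<le> w x - \<phi> x)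
        \<longrightarrow> A x * norm (p + g x) \<le> \<mu>)"

definition lipschitz_functions :: "(real ^ 'n \<Rightarrow> real) set" where
  "lipschitz_functions = {w. \<exists>L. L-lipschitz_on UNIV w}"

definition superlevel :: "(real ^ 'n \<Rightarrow> real) \<Rightarrow> (real ^ 'n) set \<Rightarrow> real \<Rightarrow> (real ^ 'n) set" where
  "superlevel A U \<delta> = {x \<in> U. \<bar>A x\<bar> > \<delta>}"

text \<open>
  \<open>\<delta>b\<close> is the threshold \<open>\<eta> \<mapsto> \<delta>b \<eta>\<close>, defined for the small \<open>\<eta>\<close>, i.e. \<open>0 < \<eta> < \<eta>0\<close>.  It depends on
  \<open>\<eta>\<close> alone: one threshold serves all realisations \<open>\<omega>\<close>, and so all members \<open>w\<close> of the classes
  \<open>S\<^sub>\<mu>(U(\<omega>))\<close>.  If each \<open>w\<close> could choose its own threshold, the defining condition would hold for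
  every Lipschitz \<open>w\<close> (let \<open>K\<close> be a positive Lipschitz constant and \<open>\<delta>b \<eta> = min \<eta> (\<mu> / K)\<close>).
\<close>

definition admissible_threshold :: "(real \<Rightarrow> real) \<Rightarrow> real \<Rightarrow> bool" where
  "admissible_threshold \<delta>b \<eta>0 \<longleftrightarrow>
     \<eta>0 > 0 \<and> (\<forall>\<eta>. 0 < \<eta> \<and> \<eta> < \<eta>0 \<longrightarrow> \<delta>b \<eta> > 0) \<and> (\<delta>b \<longlongrightarrow> 0) (at_right 0)"

definition S_class ::
    "(real \<Rightarrow> real) \<Rightarrow> real \<Rightarrow> (real ^ 'n \<Rightarrow> real) \<Rightarrow> (real ^ 'n) set \<Rightarrow> real \<Rightarrow> (real ^ 'n \<Rightarrow> real) set" where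
  "S_class \<delta>b \<eta>0 A U \<mu> =
     {w. \<forall>\<eta> \<delta>. 0 < \<eta> \<and> \<eta> < \<eta>0 \<and> 0 < \<delta> \<and> \<delta> < \<delta>b \<eta> \<longrightarrow>
           (\<forall>y1\<in>superlevel A U \<delta>. \<forall>y2\<in>superlevel A U \<delta>.
              \<bar>w y1 - w y2\<bar> \<le> (\<mu> / \<delta> + \<eta>) * norm (y1 - y2))}"

definition L_class ::
    "(real \<Rightarrow> real) \<Rightarrow> real \<Rightarrow> (real ^ 'n \<Rightarrow> real) \<Rightarrow> (real ^ 'n) set \<Rightarrow> real \<Rightarrow> (real ^ 'n \<Rightarrow> real) set" where
  "L_class \<delta>b \<eta>0 A U \<mu> = lipschitz_functions \<inter> S_class \<delta>b \<eta>0 A U \<mu>"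

definition maximal_subsol ::
    "(real \<Rightarrow> real) \<Rightarrow> real \<Rightarrow> (real ^ 'n \<Rightarrow> real) \<Rightarrow> (real ^ 'n) set \<Rightarrow>
     real \<Rightarrow> real ^ 'n \<Rightarrow> real ^ 'n \<Rightarrow> ereal" where
  "maximal_subsol \<delta>b \<eta>0 A U \<mu> y z =
     (SUP w\<in>{w \<in> L_class \<delta>b \<eta>0 A U \<mu>. w z = 0 \<and> viscosity_subsol A U 0 \<mu> w}. ereal (w y))"

section \<open>The effective Hamiltonian\<close>

definition S_plus :: "(real ^ 'n \<Rightarrow> real) set" where
  "S_plus = {w \<in> lipschitz_functions. Liminf at_infinity (\<lambda>y. ereal (w y / norm y)) \<ge> 0}"

definition hamiltonian_at ::
    "(real \<Rightarrow> real) \<Rightarrow> real \<Rightarrow> (real ^ 'n \<Rightarrow> real) \<Rightarrow> (real ^ 'n) set \<Rightarrow> real ^ 'n \<Rightarrow> ereal" where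
  "hamiltonian_at \<delta>b \<eta>0 A U p =
     Inf (ereal ` {\<mu>. \<mu> > 0 \<and>
       (\<exists>w\<in>S_plus. (\<lambda>y. w y + p \<bullet> y) \<in> L_class \<delta>b \<eta>0 A U \<mu> \<and> viscosity_subsol A U p \<mu> w)})"

text \<open>The effective Hamiltonian is the value that the infimum takes for almost every \<open>\<omega>\<close>.\<close>

definition effective_hamiltonian ::
    "(real \<Rightarrow> real) \<Rightarrow> real \<Rightarrow> 'w measure \<Rightarrow> (real ^ 'n \<Rightarrow> 'w \<Rightarrow> 'w) \<Rightarrow> (real ^ 'n \<Rightarrow> 'w \<Rightarrow> real) \<Rightarrow>
     'w set \<Rightarrow> real ^ 'n \<Rightarrow> ereal" where
  "effective_hamiltonian \<delta>b \<eta>0 M \<tau> a V p =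
     (THE h. AE \<omega> in M. hamiltonian_at \<delta>b \<eta>0 (\<lambda>y. a y \<omega>) (region \<tau> V \<omega>) p = h)"

end

theory Submission
  imports Defs
begin

text \<open>
  A subsolution is the same as a Lipschitz function obeying a family of pairwise bounds
  \<open>w y - w x \<le> \<kappa> \<bar>x - y\<bar>\<close>, so sums of \<open>\<kappa> \<bar>x - y\<bar>\<close> along chains dominate its increments.  Conversely, if
  the chain distance of level \<open>\<mu>\<close> between points of a dense set grows at least like \<open>p \<bullet> y - o(\<bar>y\<bar>)\<close>,
  restricting it to \<open>U\<^sup>\<delta>\<close> and extending with slope about \<open>\<mu>/\<delta>\<close> gives a globally Lipschitz subsolution of
  every level \<open>\<mu>' > \<mu>\<close>: near the boundary of \<open>U\<close> the steep slope is allowed since \<open>a \<le> \<delta>\<close> there.  This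
  makes the claimed equivalence true for each single \<open>\<omega>\<close>, with the Hamiltonian computed at \<open>\<omega>\<close>; probability
  enters only to show that this Hamiltonian is almost surely constant, simultaneously in \<open>p\<close>.  With a
  countable dense set, growth of the chain distance is a measurable event, and letting \<open>\<mu>'\<close> decrease to
  \<open>\<mu>\<close> makes it independent of the dense set, hence invariant under all translations.
\<close>

section \<open>Inequalities passing from a dense set to an open set\<close>

lemma lipschitz_bound_from_dense:
  fixes v :: "'a::metric_space \<Rightarrow> real"
  assumes "open W" and dense: "closure D = UNIV" and cont: "continuous_on UNIV v"
    and le: "\<And>x y. x \<in> D \<inter> W \<Longrightarrow> y \<in> D \<inter> W \<Longrightarrow> v y - v x \<le> c * dist x y"
    and "x \<in> W" "y \<in> W"
  shows "v y - v x \<le> c * dist x y"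
proof -
  have cl: "W \<subseteq> closure (D \<inter> W)"
    using open_Int_closure_subset[OF \<open>open W\<close>, of D] dense by (simp add: Int_commute)
  obtain X where X: "\<And>k. X k \<in> D \<inter> W" "X \<longlonglongrightarrow> x"
    using cl \<open>x \<in> W\<close> closure_sequential by (metis subsetD)
  obtain Y where Y: "\<And>k. Y k \<in> D \<inter> W" "Y \<longlonglongrightarrow> y"
    using cl \<open>y \<in> W\<close> closure_sequential by (metis subsetD)
  have "(\<lambda>k. v (Y k) - v (X k)) \<longlonglongrightarrow> v y - v x"
    using X Y cont by (intro tendsto_diff) (auto intro: continuous_on_tendsto_compose)
  moreover have "(\<lambda>k. c * dist (X k) (Y k)) \<longlonglongrightarrow> c * dist x y"
    using X Y by (intro tendsto_intros)
  ultimately show ?thesis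
    using le X(1) Y(1) by (intro LIMSEQ_le) auto
qed

lemma ge_on_open_from_dense:
  fixes A :: "'a::metric_space \<Rightarrow> real"
  assumes "open W" and "closure D = UNIV" and cont: "continuous_on UNIV A"
    and le: "\<And>u. u \<in> D \<inter> W \<Longrightarrow> c \<le> A u" and "x \<in> W"
  shows "c \<le> A x"
proof -
  have cl: "W \<subseteq> closure (D \<inter> W)"
    using open_Int_closure_subset[OF \<open>open W\<close>, of D] assms(2) by (simp add: Int_commute)
  obtain X where X: "\<And>k. X k \<in> D \<inter> W" "X \<longlonglongrightarrow> x"
    using cl \<open>x \<in> W\<close> closure_sequential by (metis subsetD)
  have "(\<lambda>k. A (X k)) \<longlonglongrightarrow> A x"
    using X cont by (auto intro: continuous_on_tendsto_compose)
  then show ?thesis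
    using le X(1) by (intro LIMSEQ_le_const) auto
qed

section \<open>Viscosity subsolutions and local Lipschitz bounds\<close>

lemma viscosity_subsolD:
  assumes "viscosity_subsol A U p \<mu> w" and "x \<in> U"
    and "\<forall>y\<in>U. (\<phi> has_derivative (\<lambda>h. g y \<bullet> h)) (at y)" and "continuous_on U g"
    and "\<forall>\<^sub>F y in nhds x. w y - \<phi> y \<le> w x - \<phi> x"
  shows "A x * norm (p + g x) \<le> \<mu>"
  using assms unfolding viscosity_subsol_def by blast

lemma viscosity_subsol_shift:
  fixes B :: "real ^ 'n \<Rightarrow> real"
  shows
  "viscosity_subsol B W p \<mu> w \<longleftrightarrow> viscosity_subsol B W 0 \<mu> (\<lambda>y. w y + p \<bullet> y)"
proof
  assume w: "viscosity_subsol B W p \<mu> w"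
  show "viscosity_subsol B W 0 \<mu> (\<lambda>y. w y + p \<bullet> y)"
    unfolding viscosity_subsol_def
  proof (intro allI ballI impI, elim conjE)
    fix \<phi> :: "real ^ 'n \<Rightarrow> real" and g x
    assume x: "x \<in> W" and der: "\<forall>y\<in>W. (\<phi> has_derivative (\<lambda>h. g y \<bullet> h)) (at y)"
      and g: "continuous_on W g"
      and max: "\<forall>\<^sub>F y in nhds x. w y + p \<bullet> y - \<phi> y \<le> w x + p \<bullet> x - \<phi> x"
    have "\<forall>y\<in>W. ((\<lambda>y. \<phi> y - p \<bullet> y) has_derivative (\<lambda>h. (g y - p) \<bullet> h)) (at y)"
      using der by (auto intro!: derivative_eq_intros simp: inner_diff_left)
    moreover have "continuous_on W (\<lambda>y. g y - p)" using g by (intro continuous_intros)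
    moreover have "\<forall>\<^sub>F y in nhds x. w y - (\<phi> y - p \<bullet> y) \<le> w x - (\<phi> x - p \<bullet> x)"
      using max by eventually_elim simp
    ultimately have "B x * norm (p + (g x - p)) \<le> \<mu>" by (rule viscosity_subsolD[OF w x])
    then show "B x * norm (0 + g x) \<le> \<mu>" by simp
  qed
next
  assume w: "viscosity_subsol B W 0 \<mu> (\<lambda>y. w y + p \<bullet> y)"
  show "viscosity_subsol B W p \<mu> w"
    unfolding viscosity_subsol_def
  proof (intro allI ballI impI, elim conjE)
    fix \<phi> :: "real ^ 'n \<Rightarrow> real" and g x
    assume x: "x \<in> W" and der: "\<forall>y\<in>W. (\<phi> has_derivative (\<lambda>h. g y \<bullet> h)) (at y)"
      and g: "continuous_on W g" and max: "\<forall>\<^sub>F y in nhds x. w y - \<phi> y \<le> w x - \<phi> x"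
    have "\<forall>y\<in>W. ((\<lambda>y. \<phi> y + p \<bullet> y) has_derivative (\<lambda>h. (g y + p) \<bullet> h)) (at y)"
      using der by (auto intro!: derivative_eq_intros simp: inner_add_left)
    moreover have "continuous_on W (\<lambda>y. g y + p)" using g by (intro continuous_intros)
    moreover have "\<forall>\<^sub>F y in nhds x. w y + p \<bullet> y - (\<phi> y + p \<bullet> y) \<le> w x + p \<bullet> x - (\<phi> x + p \<bullet> x)"
      using max by eventually_elim simp
    ultimately have "B x * norm (0 + (g x + p)) \<le> \<mu>" by (rule viscosity_subsolD[OF w x])
    then show "B x * norm (p + g x) \<le> \<mu>" by (simp add: add.commute)
  qed
qed

text \<open>Where \<open>w - \<phi>\<close> has a local maximum, \<open>w\<close> falls at least as
  fast as \<open>\<phi>\<close>. Along the steepest descent of \<open>\<phi>\<close> that rate is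
  the norm of its gradient, so a bound on the downward slope of \<open>w\<close> at \<open>x\<close>
  bounds the gradient.\<close>

lemma viscosity_subsol_if_local_slope:
  fixes A w :: "real ^ 'n \<Rightarrow> real"
  assumes "\<And>x. x \<in> U \<Longrightarrow> A x > 0" and "\<mu> > 0"
    and slope: "\<And>x k. x \<in> U \<Longrightarrow> \<mu> < k * A x \<Longrightarrow> \<exists>r>0. \<forall>y\<in>ball x r. w x - w y \<le> k * dist x y"
  shows "viscosity_subsol A U 0 \<mu> w"
  unfolding viscosity_subsol_def
proof (intro allI ballI impI, elim conjE)
  fix \<phi> :: "real ^ 'n \<Rightarrow> real" and g x
  assume x: "x \<in> U" and der: "\<forall>y\<in>U. (\<phi> has_derivative (\<lambda>h. g y \<bullet> h)) (at y)"
    and max: "\<forall>\<^sub>F y in nhds x. w y - \<phi> y \<le> w x - \<phi> x"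
  show "A x * norm (0 + g x) \<le> \<mu>"
  proof (rule ccontr)
    assume "\<not> ?thesis"
    then have big: "\<mu> < norm (g x) * A x" by (simp add: mult.commute)
    have Ax: "A x > 0" using assms(1) x .
    have "\<mu> / A x < norm (g x)" using big Ax by (simp add: field_simps)
    then obtain k where k: "\<mu> / A x < k" "k < norm (g x)" using dense by blast
    have "0 < \<mu> / A x" using Ax \<open>\<mu> > 0\<close> by simp
    then have "0 < k" using k(1) by (rule less_trans)
    then have kg: "k < norm (g x)" "\<mu> < k * A x" "norm (g x) > 0"
      using Ax k by (simp_all add: pos_divide_less_eq del: zero_less_norm_iff)
    obtain r where r: "r > 0" "\<forall>y\<in>ball x r. w x - w y \<le> k * dist x y"
      using slope[OF x kg(2)] by blast
    \<comment> \<open>\<open>\<gamma>\<close> leaves \<open>x\<close> in direction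
      \<open>- g x\<close>: \<open>\<phi>\<close> decreases at rate
      \<open>(norm (g x))\<^sup>2\<close> in \<open>t\<close>, while the distance to
      \<open>x\<close> is only \<open>t * norm (g x)\<close>.\<close>
    define \<gamma> where "\<gamma> = (\<lambda>t::real. x - t *\<^sub>R g x)"
    have d: "(\<phi> \<circ> \<gamma> has_derivative (\<lambda>t. g x \<bullet> (- t *\<^sub>R g x))) (at 0)"
      unfolding comp_def
      apply (rule has_derivative_compose[of \<gamma>])
      using der x by (auto simp: \<gamma>_def intro!: derivative_eq_intros)
    then have "((\<phi> \<circ> \<gamma>) has_real_derivative - (norm (g x))\<^sup>2) (at 0)"
      unfolding has_field_derivative_def
      by (rule has_derivative_eq_rhs) (auto simp: dot_square_norm power2_eq_square)
    then have "((\<phi> \<circ> \<gamma>) has_real_derivative - (norm (g x))\<^sup>2) (at_right 0)"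
      by (rule has_field_derivative_at_within)
    then have lim: "((\<lambda>t. ((\<phi> \<circ> \<gamma>) t - (\<phi> \<circ> \<gamma>) 0) / t) \<longlongrightarrow> - (norm (g x))\<^sup>2) (at_right 0)"
      unfolding has_field_derivative_iff by (simp only: diff_0_right)
    have g0: "(\<gamma> \<longlongrightarrow> x) (at_right 0)"
      unfolding \<gamma>_def by (rule tendsto_eq_intros refl | simp)+
    have "\<forall>\<^sub>F y in nhds x. y \<in> ball x r" using r by (intro eventually_nhds_in_open) auto
    then have ev: "\<forall>\<^sub>F t in at_right 0. w (\<gamma> t) - \<phi> (\<gamma> t) \<le> w x - \<phi> x \<and> \<gamma> t \<in> ball x r"
      using max g0 by (intro eventually_conj) (auto simp: filterlim_iff)
    have "\<forall>\<^sub>F t in at_right 0. - k * norm (g x) \<le> ((\<phi> \<circ> \<gamma>) t - (\<phi> \<circ> \<gamma>) 0) / t"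
      using ev eventually_at_right_less[of "0::real"]
    proof eventually_elim
      case (elim t)
      then have "w x - w (\<gamma> t) \<le> k * dist x (\<gamma> t)" using r by blast
      moreover have "dist x (\<gamma> t) = t * norm (g x)" using elim by (simp add: \<gamma>_def dist_norm)
      ultimately have "- k * (t * norm (g x)) \<le> \<phi> (\<gamma> t) - \<phi> x" using elim by simp
      then show ?case using elim by (simp add: \<gamma>_def field_simps)
    qed
    then have "- k * norm (g x) \<le> - (norm (g x))\<^sup>2"
      by (rule tendsto_lowerbound[OF lim]) simp
    then show False using kg by (simp add: power2_eq_square)
  qed
qed

text \<open>
  The test function is \<open>k * sqrt (\<bar>u - x\<bar>\<^sup>2 + s\<^sup>2)\<close> plus a penalty that is negligible at \<open>y\<close> and exceeds the
  oscillation of \<open>w\<close> on the sphere of radius \<open>\<rho>\<close>; both gradients point away from \<open>x\<close>, so they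
  cannot cancel.
\<close>

lemma viscosity_subsol_lipschitz_on_ball:
  fixes A w :: "real ^ 'n \<Rightarrow> real"
  assumes visc: "viscosity_subsol A U 0 \<mu> w" and lip: "L-lipschitz_on UNIV w"
    and sub: "cball x \<rho> \<subseteq> U" and A: "\<And>u. u \<in> cball x \<rho> \<Longrightarrow> \<mu> \<le> \<kappa> * A u"
    and "\<mu> > 0" "\<kappa> > 0" and y: "dist x y < \<rho>"
  shows "w y - w x \<le> \<kappa> * dist x y"
proof (rule ccontr)
  assume neg: "\<not> ?thesis"
  define d where "d = dist x y"
  have gap: "w y - w x > \<kappa> * d" using neg by (simp add: d_def)
  then have d: "d > 0" by (cases "x = y") (auto simp: d_def)
  have \<rho>: "d < \<rho>" "\<rho> > 0" using y d less_trans unfolding d_def by blast+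
  have "\<kappa> < (w y - w x) / d" using gap d by (simp add: field_simps)
  \<comment> \<open>\<open>k\<close> lies strictly between \<open>\<kappa>\<close> and the supposed
    difference quotient: \<open>G\<close> is the room on one side, \<open>k - \<kappa>\<close> the
    room for smoothing the cone.\<close>
  then obtain k where k: "k > \<kappa>" "k < (w y - w x) / d" using dense by blast
  define G where "G = w y - w x - k * d"
  have G: "G > 0" using k d by (simp add: G_def field_simps)
  have k0: "k > 0" using k \<open>\<kappa> > 0\<close> by linarith
  define L' where "L' = max L 1"
  have L': "L' > 0" "L \<le> L'" by (auto simp: L'_def)
  have wL: "w u - w x \<le> L' * dist x u" for u
  proof -
    have "dist (w x) (w u) \<le> L * dist x u" using lipschitz_onD[OF lip] by simp
    also have "\<dots> \<le> L' * dist x u" using L' by (simp add: mult_right_mono)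
    finally show ?thesis by (simp add: dist_real_def)
  qed
  \<comment> \<open>Within distance \<open>r0\<close> of \<open>x\<close>, \<open>w\<close> rises by
    at most \<open>G / 3\<close>; the maximum found below lies farther out.\<close>
  define r0 where "r0 = G / (3 * L')"
  have r0: "r0 > 0" using G L' by (simp add: r0_def)
  \<comment> \<open>First bound: smoothing the tip of the cone costs at most \<open>G / 3\<close> at
    \<open>y\<close>. Second bound: beyond distance \<open>r0\<close> the smoothed cone still has
    slope above \<open>\<kappa>\<close>; the factor 2 makes this strict.\<close>
  define s where "s = min (G / (3 * k)) (r0 * sqrt (k\<^sup>2 - \<kappa>\<^sup>2) / (2 * \<kappa>))"
  have kk: "k\<^sup>2 - \<kappa>\<^sup>2 > 0" using k \<open>\<kappa> > 0\<close> by (simp add: power_strict_mono)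
  then have s0: "s > 0" using G k0 r0 \<open>\<kappa> > 0\<close> by (simp add: s_def)
  have s1: "k * s \<le> G / 3"
  proof -
    have "s \<le> G / (3 * k)" by (simp add: s_def)
    then show ?thesis using k0 by (simp add: field_simps)
  qed
  have s2: "\<kappa> * s < r0 * sqrt (k\<^sup>2 - \<kappa>\<^sup>2)"
  proof -
    have "\<kappa> * s \<le> \<kappa> * (r0 * sqrt (k\<^sup>2 - \<kappa>\<^sup>2) / (2 * \<kappa>))"
      using \<open>\<kappa> > 0\<close> by (intro mult_left_mono) (simp_all add: s_def)
    also have "\<dots> = r0 * sqrt (k\<^sup>2 - \<kappa>\<^sup>2) / 2" using \<open>\<kappa> > 0\<close> by simp
    also have "\<dots> < r0 * sqrt (k\<^sup>2 - \<kappa>\<^sup>2)" using r0 kk by simp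
    finally show ?thesis .
  qed
  have s3: "\<kappa>\<^sup>2 * s\<^sup>2 < r0\<^sup>2 * (k\<^sup>2 - \<kappa>\<^sup>2)"
  proof -
    have "(\<kappa> * s)\<^sup>2 < (r0 * sqrt (k\<^sup>2 - \<kappa>\<^sup>2))\<^sup>2"
      using s2 s0 \<open>\<kappa> > 0\<close> by (intro power_strict_mono) auto
    then show ?thesis using kk by (simp add: power_mult_distrib)
  qed
  \<comment> \<open>\<open>\<sigma>\<close> bounds the rise of \<open>w\<close> from
    \<open>x\<close> to the sphere of radius \<open>\<rho>\<close>, where the penalty equals
    \<open>\<sigma>\<close>. As \<open>d < \<rho>\<close>, a high power makes the penalty smaller
    than \<open>G / 3\<close> at \<open>y\<close>.\<close>
  define \<sigma> where "\<sigma> = L' * \<rho>"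
  have \<sigma>: "\<sigma> > 0" using L' \<rho> by (simp add: \<sigma>_def)
  have q1: "d\<^sup>2 / \<rho>\<^sup>2 < 1" "d\<^sup>2 / \<rho>\<^sup>2 \<ge> 0" using \<rho> d by (auto simp: power_strict_mono)
  obtain N0 where N0: "(d\<^sup>2 / \<rho>\<^sup>2) ^ N0 < G / (3 * \<sigma>)"
    using real_arch_pow_inv[of "G / (3 * \<sigma>)" "d\<^sup>2 / \<rho>\<^sup>2"] q1 G \<sigma> by auto
  define N where "N = Suc N0"
  have N: "\<sigma> * (d\<^sup>2 / \<rho>\<^sup>2) ^ N < G / 3"
  proof -
    have "(d\<^sup>2 / \<rho>\<^sup>2) ^ N \<le> (d\<^sup>2 / \<rho>\<^sup>2) ^ N0"
      using q1 unfolding N_def by (intro power_decreasing) auto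
    then have "(d\<^sup>2 / \<rho>\<^sup>2) ^ N < G / (3 * \<sigma>)" using N0 by linarith
    then show ?thesis using \<sigma> by (simp add: field_simps)
  qed
  define q where "q = (\<lambda>u. (u - x) \<bullet> (u - x))"
  have q: "q u = (dist x u)\<^sup>2" for u
    by (simp add: q_def dist_norm norm_minus_commute power2_norm_eq_inner)
  define \<phi> where "\<phi> = (\<lambda>u. k * sqrt (q u + s\<^sup>2) + \<sigma> * (q u / \<rho>\<^sup>2) ^ N)"
  \<comment> \<open>\<open>c u / 2\<close> is the derivative of the profile of \<open>\<phi>\<close>
    in the variable \<open>q u\<close>, so the gradient is radial with factor
    \<open>c u\<close>.\<close>
  define c where "c = (\<lambda>u. k / sqrt (q u + s\<^sup>2) + 2 * \<sigma> * N / \<rho>\<^sup>2 * (q u / \<rho>\<^sup>2) ^ N0)"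
  define g where "g = (\<lambda>u. c u *\<^sub>R (u - x))"
  have pos: "q u + s\<^sup>2 > 0" for u using s0 by (simp add: q add_nonneg_pos)
  have der: "(\<phi> has_derivative (\<lambda>h. g u \<bullet> h)) (at u)" for u
  proof -
    have "(q has_derivative (\<lambda>h. 2 * ((u - x) \<bullet> h))) (at u)"
      unfolding q_def by (auto intro!: derivative_eq_intros simp: inner_commute)
    moreover have "((\<lambda>t. k * sqrt (t + s\<^sup>2) + \<sigma> * (t / \<rho>\<^sup>2) ^ N) has_real_derivative c u / 2) (at (q u))"
    proof -
      have "((\<lambda>t. sqrt (t + s\<^sup>2)) has_real_derivative 1 / (2 * sqrt (q u + s\<^sup>2))) (at (q u))"
        using pos[of u] by (auto intro!: derivative_eq_intros simp: field_simps)
      moreover have "((\<lambda>t. (t / \<rho>\<^sup>2) ^ N) has_real_derivative (1 + real N0) * (1 / \<rho>\<^sup>2 * (q u / \<rho>\<^sup>2) ^ N0)) (at (q u))"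
        unfolding N_def
        using DERIV_power_Suc[OF DERIV_cdivide[OF DERIV_ident, of "\<rho>\<^sup>2"], where x = "q u" and n = N0] by simp
      ultimately have "((\<lambda>t. k * sqrt (t + s\<^sup>2) + \<sigma> * (t / \<rho>\<^sup>2) ^ N) has_real_derivative
          k * (1 / (2 * sqrt (q u + s\<^sup>2))) + \<sigma> * ((1 + real N0) * (1 / \<rho>\<^sup>2 * (q u / \<rho>\<^sup>2) ^ N0))) (at (q u))"
        by (intro DERIV_add DERIV_cmult)
      then show ?thesis
        by (rule DERIV_cong) (simp add: c_def N_def add_divide_distrib)
    qed
    ultimately have "(\<phi> has_derivative (\<lambda>h. 2 * ((u - x) \<bullet> h) * (c u / 2))) (at u)"
      unfolding \<phi>_def by (rule DERIV_compose_FDERIV[rotated])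
    then show ?thesis by (simp add: g_def mult.commute)
  qed
  have contg: "continuous_on S g" for S
    unfolding g_def c_def q_def
    using pos \<rho> by (intro continuous_intros) (auto simp: q_def less_imp_neq[THEN not_sym])
  have contw: "continuous_on UNIV w" using lipschitz_on_continuous_on[OF lip] .
  have cont\<phi>: "continuous_on UNIV \<phi>"
    using der by (meson has_derivative_continuous_on has_derivative_at_withinI)
  have "continuous_on (cball x \<rho>) (\<lambda>u. w u - \<phi> u)"
    using contw cont\<phi> by (intro continuous_on_diff) (auto intro: continuous_on_subset)
  then obtain m where m: "m \<in> cball x \<rho>" "\<And>u. u \<in> cball x \<rho> \<Longrightarrow> w u - \<phi> u \<le> w m - \<phi> m"
    using continuous_attains_sup[of "cball x \<rho>" "\<lambda>u. w u - \<phi> u"] \<rho> by auto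
  have "sqrt (d\<^sup>2 + s\<^sup>2) \<le> d + s" using sqrt_sum_squares_le_sum[of d s] d s0 by simp
  then have "k * sqrt (d\<^sup>2 + s\<^sup>2) \<le> k * d + G / 3"
    using mult_left_mono[of "sqrt (d\<^sup>2 + s\<^sup>2)" "d + s" k] k0 s1 by (simp add: distrib_left)
  then have "w y - \<phi> y > w x + G / 3"
  proof -
    assume "k * sqrt (d\<^sup>2 + s\<^sup>2) \<le> k * d + G / 3"
    moreover have "\<phi> y = k * sqrt (d\<^sup>2 + s\<^sup>2) + \<sigma> * (d\<^sup>2 / \<rho>\<^sup>2) ^ N"
      by (simp add: \<phi>_def q d_def)
    moreover have "w y = w x + k * d + G" by (simp add: G_def)
    ultimately show ?thesis using N by linarith
  qed
  then have wm: "w m - \<phi> m > w x + G / 3" using m(2)[of y] y by simp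
  have \<phi>1: "\<phi> u \<ge> \<sigma> * (q u / \<rho>\<^sup>2) ^ N" for u
    using k0 pos[of u] by (simp add: \<phi>_def)
  have \<phi>0: "\<phi> u \<ge> 0" for u
    using \<phi>1[of u] \<sigma> by (smt (verit) divide_nonneg_nonneg mult_nonneg_nonneg q zero_le_power zero_le_power2)
  have int: "dist x m < \<rho>"
  proof (rule ccontr)
    assume "\<not> ?thesis"
    then have "dist x m = \<rho>" using m(1) by simp
    then have "\<phi> m \<ge> \<sigma>" using \<phi>1[of m] \<rho> by (simp add: q)
    then show False using wm wL[of m] \<open>dist x m = \<rho>\<close> G by (simp add: \<sigma>_def)
  qed
  have "G / 3 < L' * dist x m" using wm wL[of m] \<phi>0[of m] by linarith
  then have rm: "r0 < dist x m" using L' by (simp add: r0_def field_simps)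
  have "\<forall>\<^sub>F u in nhds m. u \<in> ball x \<rho>" using int by (intro eventually_nhds_in_open) auto
  then have "\<forall>\<^sub>F u in nhds m. w u - \<phi> u \<le> w m - \<phi> m"
    by eventually_elim (use m(2) in auto)
  moreover have "m \<in> U" using m sub by blast
  ultimately have small: "A m * norm (0 + g m) \<le> \<mu>"
    using visc der contg unfolding viscosity_subsol_def by blast
  \<comment> \<open>Beyond \<open>r0\<close> the choice of \<open>s\<close> keeps the cone part of
    the gradient above \<open>\<kappa>\<close>; the penalty only adds to it.\<close>
  have "\<kappa>\<^sup>2 * ((dist x m)\<^sup>2 + s\<^sup>2) < k\<^sup>2 * (dist x m)\<^sup>2"
  proof -
    have "r0\<^sup>2 * (k\<^sup>2 - \<kappa>\<^sup>2) \<le> (dist x m)\<^sup>2 * (k\<^sup>2 - \<kappa>\<^sup>2)"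
      using rm r0 kk by (intro mult_right_mono power_mono) auto
    then show ?thesis using s3 by (simp add: algebra_simps)
  qed
  then have "sqrt (\<kappa>\<^sup>2 * ((dist x m)\<^sup>2 + s\<^sup>2)) < sqrt (k\<^sup>2 * (dist x m)\<^sup>2)" by simp
  then have "\<kappa> * sqrt (q m + s\<^sup>2) < k * dist x m"
    using \<open>\<kappa> > 0\<close> k0 by (simp add: real_sqrt_mult q)
  then have "\<kappa> < k / sqrt (q m + s\<^sup>2) * dist x m"
    using pos[of m] by (simp add: field_simps)
  also have "\<dots> \<le> c m * dist x m"
    using \<sigma> by (intro mult_right_mono) (auto simp: c_def q)
  also have "\<dots> \<le> norm (g m)"
    by (simp add: g_def dist_norm norm_minus_commute mult_right_mono)
  finally have ng: "\<kappa> < norm (g m)" .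
  have "0 < \<kappa> * A m" using A[OF m(1)] \<open>\<mu> > 0\<close> by linarith
  then have "A m > 0" using \<open>\<kappa> > 0\<close> by (simp add: zero_less_mult_iff)
  then have "\<kappa> * A m < A m * norm (g m)" using ng by (simp add: mult.commute)
  then show False using small A[OF m(1)] by simp
qed

section \<open>Chains of points of a dense set\<close>

text \<open>
  An edge \<open>x, y\<close> of weight \<open>\<kappa>\<close> encodes \<open>w y - w x \<le> \<kappa> \<bar>x - y\<bar>\<close>: the first alternative comes from the class
  \<open>S\<^sub>\<mu>\<close>, the second from the equation.  All times and weights in a chain are rational, so that the
  existence of a chain is a countable union of events when \<open>A\<close> and \<open>U\<close> are random.
\<close>

definition edge :: "(real \<Rightarrow> real) \<Rightarrow> real \<Rightarrow> (real ^ 'n \<Rightarrow> real) \<Rightarrow> (real ^ 'n) set \<Rightarrow> (real ^ 'n) set \<Rightarrow>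
    real \<Rightarrow> real \<Rightarrow> real ^ 'n \<Rightarrow> real ^ 'n \<Rightarrow> bool" where
  "edge \<delta>b \<eta>0 A U D \<mu> \<kappa> x y \<longleftrightarrow> x \<in> U \<and> y \<in> U \<and>
     ((\<exists>\<eta> \<delta>. 0 < \<eta> \<and> \<eta> < \<eta>0 \<and> 0 < \<delta> \<and> \<delta> < \<delta>b \<eta> \<and> \<delta> < A x \<and> \<delta> < A y \<and> \<mu> / \<delta> + \<eta> \<le> \<kappa>) \<or>
      (\<forall>u\<in>D. dist x u < 2 * dist x y \<longrightarrow> 0 < A u \<and> \<mu> \<le> \<kappa> * A u))"

primrec chain :: "(real \<Rightarrow> real) \<Rightarrow> real \<Rightarrow> (real ^ 'n \<Rightarrow> real) \<Rightarrow> (real ^ 'n) set \<Rightarrow> (real ^ 'n) set \<Rightarrow>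
    real \<Rightarrow> real ^ 'n \<Rightarrow> nat \<Rightarrow> real \<Rightarrow> real ^ 'n \<Rightarrow> bool" where
  "chain \<delta>b \<eta>0 A U D \<mu> z 0 t y \<longleftrightarrow> y = z \<and> 0 \<le> t"
| "chain \<delta>b \<eta>0 A U D \<mu> z (Suc n) t y \<longleftrightarrow>
     (\<exists>x\<in>D. \<exists>s\<in>\<rat>. \<exists>\<kappa>\<in>\<rat>. chain \<delta>b \<eta>0 A U D \<mu> z n s x \<and> edge \<delta>b \<eta>0 A U D \<mu> \<kappa> x y \<and> s + \<kappa> * dist x y \<le> t)"

text \<open>In \<open>chain\<close> the number \<open>t\<close> only has to dominate the length, so
  rational \<open>t\<close> approximate every length. With a natural constant \<open>C\<close>, all
  quantifiers are countable when \<open>D\<close> is; \<open>C\<close> also absorbs the effect of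
  the base point.\<close>

definition chain_growth :: "(real \<Rightarrow> real) \<Rightarrow> real \<Rightarrow> (real ^ 'n \<Rightarrow> real) \<Rightarrow> (real ^ 'n) set \<Rightarrow> (real ^ 'n) set \<Rightarrow>
    real \<Rightarrow> real ^ 'n \<Rightarrow> real \<Rightarrow> real ^ 'n \<Rightarrow> bool" where
  "chain_growth \<delta>b \<eta>0 A U D \<mu> p \<epsilon> z \<longleftrightarrow>
     (\<exists>C::nat. \<forall>y\<in>D. \<forall>n. \<forall>t\<in>\<rat>. chain \<delta>b \<eta>0 A U D \<mu> z n t y \<longrightarrow> p \<bullet> y - \<epsilon> * norm y - C \<le> t)"

definition subsolutions :: "(real \<Rightarrow> real) \<Rightarrow> real \<Rightarrow> (real ^ 'n \<Rightarrow> real) \<Rightarrow> (real ^ 'n) set \<Rightarrow> real \<Rightarrow>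
    (real ^ 'n \<Rightarrow> real) set" where
  "subsolutions \<delta>b \<eta>0 A U \<mu> = {w \<in> L_class \<delta>b \<eta>0 A U \<mu>. viscosity_subsol A U 0 \<mu> w}"

text \<open>Required for all \<open>\<epsilon> > 0\<close>, this is the lower limit condition on
  \<open>(v y - p \<bullet> y) / norm y\<close> at infinity for Lipschitz \<open>v\<close>, in the
  manner of \<open>S_plus_iff\<close>.\<close>

definition growth_bound :: "(real ^ 'n \<Rightarrow> real) \<Rightarrow> real ^ 'n \<Rightarrow> real \<Rightarrow> bool" where
  "growth_bound v p \<epsilon> \<longleftrightarrow> (\<exists>C. \<forall>y. p \<bullet> y - \<epsilon> * norm y - C \<le> v y)"

section \<open>Dependence of chains on level and slope\<close>

lemma edge_mono:
  assumes "edge \<delta>b \<eta>0 A U D \<mu> \<kappa> x y" and "\<kappa> \<le> \<kappa>'"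
  shows "edge \<delta>b \<eta>0 A U D \<mu> \<kappa>' x y"
proof -
  have "\<mu> \<le> \<kappa>' * A u" if "0 < A u" "\<mu> \<le> \<kappa> * A u" for u
    using that assms(2) mult_right_mono[of \<kappa> \<kappa>' "A u"] by linarith
  then show ?thesis
    using assms unfolding edge_def by (meson order_trans)
qed

lemma edge_antimono:
  assumes "edge \<delta>b \<eta>0 A U D \<mu>' \<kappa> x y" and "\<mu> \<le> \<mu>'"
  shows "edge \<delta>b \<eta>0 A U D \<mu> \<kappa> x y"
proof -
  have "\<mu> / \<delta> + \<eta> \<le> \<kappa>" if "\<mu>' / \<delta> + \<eta> \<le> \<kappa>" "0 < \<delta>" for \<delta> \<eta>
    using divide_right_mono[OF assms(2), of \<delta>] that by linarith
  then show ?thesis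
    using assms unfolding edge_def by (meson order_trans)
qed

lemma chain_antimono:
  assumes "\<mu> \<le> \<mu>'"
  shows "chain \<delta>b \<eta>0 A U D \<mu>' z n t y \<Longrightarrow> chain \<delta>b \<eta>0 A U D \<mu> z n t y"
proof (induction n arbitrary: t y)
  case (Suc n)
  then show ?case using edge_antimono[OF _ assms] unfolding chain.simps by meson
qed simp

lemma chain_growth_mono:
  assumes "chain_growth \<delta>b \<eta>0 A U D \<mu> p \<epsilon> z" and "\<mu> \<le> \<mu>'"
  shows "chain_growth \<delta>b \<eta>0 A U D \<mu>' p \<epsilon> z"
  using assms(1) chain_antimono[OF assms(2)] unfolding chain_growth_def by meson

text \<open>By Cauchy-Schwarz the change of slope costs \<open>norm (p - q) * norm y\<close>, which
  the enlarged error term absorbs. This lets slopes from a countable dense set stand for all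
  \<open>p\<close>.\<close>

lemma chain_growth_perturb:
  assumes "chain_growth \<delta>b \<eta>0 A U D \<mu> q \<epsilon>' z" and le: "norm (p - q) + \<epsilon>' \<le> \<epsilon>"
  shows "chain_growth \<delta>b \<eta>0 A U D \<mu> p \<epsilon> z"
proof -
  have "p \<bullet> y - \<epsilon> * norm y \<le> q \<bullet> y - \<epsilon>' * norm y" for y
  proof -
    have "(p - q) \<bullet> y \<le> norm (p - q) * norm y" by (rule norm_cauchy_schwarz)
    moreover have "(norm (p - q) + \<epsilon>') * norm y \<le> \<epsilon> * norm y" using le by (intro mult_right_mono) auto
    ultimately show ?thesis by (simp add: algebra_simps)
  qed
  then have "p \<bullet> y - \<epsilon> * norm y - C \<le> t" if "q \<bullet> y - \<epsilon>' * norm y - C \<le> t" for y t and C :: real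
    using that by (smt (verit))
  then show ?thesis using assms(1) unfolding chain_growth_def by meson
qed

section \<open>Lower limits at infinity as linear lower bounds\<close>

text \<open>Far out, the two conditions agree up to the choice of \<open>\<epsilon>\<close>; on the
  remaining ball a Lipschitz function is bounded, and the constant absorbs it.\<close>

lemma S_plus_iff:
  fixes w :: "real ^ 'n \<Rightarrow> real"
  shows "w \<in> S_plus \<longleftrightarrow> w \<in> lipschitz_functions \<and> (\<forall>\<epsilon>>0. growth_bound w 0 \<epsilon>)"
proof -
  have "0 \<le> Liminf at_infinity (\<lambda>y. ereal (w y / norm y)) \<longleftrightarrow> (\<forall>\<epsilon>>0. growth_bound w 0 \<epsilon>)"
    if w: "w \<in> lipschitz_functions"
  proof
    assume lim: "0 \<le> Liminf at_infinity (\<lambda>y. ereal (w y / norm y))"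
    obtain L where L: "L-lipschitz_on UNIV w" using w by (auto simp: lipschitz_functions_def)
    show "\<forall>\<epsilon>>0. growth_bound w 0 \<epsilon>"
    proof (intro allI impI)
      fix \<epsilon> :: real assume "\<epsilon> > 0"
      then have "\<forall>\<^sub>F y in at_infinity. ereal (- \<epsilon>) < ereal (w y / norm y)"
        using lim unfolding le_Liminf_iff by (auto dest: spec[of _ "ereal (- \<epsilon>)"])
      then obtain b where b: "\<forall>y. b \<le> norm y \<longrightarrow> - \<epsilon> < w y / norm y"
        by (auto simp: eventually_at_infinity)
      define C where "C = \<bar>w 0\<bar> + L * max b 1"
      have L0: "L \<ge> 0" using L by (rule lipschitz_on_nonneg)
      then have C0: "C \<ge> 0" by (simp add: C_def)
      have "0 \<bullet> y - \<epsilon> * norm y - C \<le> w y" for y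
      proof (cases "max b 1 \<le> norm y")
        case True
        then have "norm y > 0" "- \<epsilon> < w y / norm y" using b by auto
        then show ?thesis using C0 by (simp add: field_simps)
      next
        case False
        have "\<bar>w y - w 0\<bar> \<le> L * norm y"
          using lipschitz_onD[OF L, of y 0] by (simp add: dist_norm)
        also have "\<dots> \<le> L * max b 1" using False L0 by (intro mult_left_mono) auto
        finally have "- C \<le> w y" by (simp add: C_def)
        then show ?thesis using \<open>\<epsilon> > 0\<close> by (simp add: add_increasing2 algebra_simps)
          (smt (verit) mult_nonneg_nonneg norm_ge_zero)
      qed
      then show "growth_bound w 0 \<epsilon>" unfolding growth_bound_def by blast
    qed
  next
    assume g: "\<forall>\<epsilon>>0. growth_bound w 0 \<epsilon>"
    show "0 \<le> Liminf at_infinity (\<lambda>y. ereal (w y / norm y))"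
      unfolding le_Liminf_iff
    proof (intro allI impI)
      fix r :: ereal assume "r < 0"
      then obtain s where s: "r < ereal s" "s < 0"
        using ereal_dense2[OF \<open>r < 0\<close>] by (auto simp: zero_ereal_def)
      \<comment> \<open>Half of the margin \<open>- s\<close> pays for the error slope, the other
        half for \<open>C\<close> once \<open>norm y\<close> is large.\<close>
      define \<epsilon> where "\<epsilon> = - s / 2"
      have \<epsilon>: "\<epsilon> > 0" "s = - 2 * \<epsilon>" using s by (auto simp: \<epsilon>_def)
      then obtain C where C: "\<forall>y. - \<epsilon> * norm y - C \<le> w y"
        using g unfolding growth_bound_def by fastforce
      have "s \<le> w y / norm y" if "max 1 (\<bar>C\<bar> / \<epsilon>) \<le> norm y" for y
      proof -
        have "\<bar>C\<bar> \<le> \<epsilon> * norm y" using that \<epsilon> by (simp add: field_simps)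
        then have "s * norm y \<le> w y" using C[rule_format, of y] \<epsilon>(2) by simp
        moreover have "norm y > 0" using that by linarith
        ultimately show ?thesis by (simp add: pos_le_divide_eq)
      qed
      then show "\<forall>\<^sub>F y in at_infinity. r < ereal (w y / norm y)"
        unfolding eventually_at_infinity
        by (intro exI[of _ "max 1 (\<bar>C\<bar> / \<epsilon>)"] allI impI less_le_trans[OF s(1)]) simp
    qed
  qed
  then show ?thesis unfolding S_plus_def by blast
qed

text \<open>Nonnegativity of \<open>m\<close> does here what the Lipschitz bound does in
  \<open>S_plus_iff\<close>: on bounded sets \<open>C\<close> makes the left side nonpositive. It
  also excludes the value \<open>- \<infinity>\<close>.\<close>

lemma Liminf_growth_iff:
  fixes m :: "real ^ 'n \<Rightarrow> ereal"
  assumes m0: "\<And>y. y \<in> W \<Longrightarrow> 0 \<le> m y"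
  shows "0 \<le> Liminf (inf at_infinity (principal W)) (\<lambda>y. (m y - ereal (p \<bullet> (y - z))) / ereal (norm y)) \<longleftrightarrow>
    (\<forall>\<epsilon>>0. \<exists>C. \<forall>y\<in>W. ereal (p \<bullet> y - \<epsilon> * norm y - C) \<le> m y)"
    (is "0 \<le> Liminf ?F ?q \<longleftrightarrow> _")
proof (intro iffI allI impI)
  fix \<epsilon> :: real assume lim: "0 \<le> Liminf ?F ?q" and "\<epsilon> > 0"
  then have "\<forall>\<^sub>F y in ?F. ereal (- \<epsilon>) < ?q y"
    unfolding le_Liminf_iff by (auto dest: spec[of _ "ereal (- \<epsilon>)"])
  then obtain b where b: "\<And>y. b \<le> norm y \<Longrightarrow> y \<in> W \<Longrightarrow> ereal (- \<epsilon>) < ?q y"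
    unfolding eventually_inf_principal eventually_at_infinity by blast
  define C where "C = \<bar>p \<bullet> z\<bar> + norm p * max b 1"
  have "ereal (p \<bullet> y - \<epsilon> * norm y - C) \<le> m y" if y: "y \<in> W" for y
  proof (cases "max b 1 \<le> norm y")
    case True
    then have n: "norm y > 0" "ereal (- \<epsilon>) < ?q y" using b y by auto
    show ?thesis
    proof (cases "m y")
      case (real r)
      have "- \<epsilon> < (r - p \<bullet> (y - z)) / norm y" using n real by simp
      then have "- \<epsilon> * norm y < r - p \<bullet> y + p \<bullet> z" using n(1) by (simp add: field_simps inner_diff_right)
      moreover have "0 \<le> norm p * max b 1" by (intro mult_nonneg_nonneg) auto
      ultimately have "p \<bullet> y - \<epsilon> * norm y - C \<le> r" unfolding C_def by linarith
      then show ?thesis using real by simp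
    qed (use m0[OF y] in auto)
  next
    case False
    have "p \<bullet> y \<le> norm p * norm y" by (rule norm_cauchy_schwarz)
    also have "\<dots> \<le> norm p * max b 1" using False by (intro mult_left_mono) auto
    finally have "p \<bullet> y - C \<le> 0" by (simp add: C_def)
    moreover have "0 \<le> \<epsilon> * norm y" using \<open>\<epsilon> > 0\<close> by simp
    ultimately have "ereal (p \<bullet> y - \<epsilon> * norm y - C) \<le> 0" by simp
    then show ?thesis using m0[OF y] by (rule order_trans)
  qed
  then show "\<exists>C. \<forall>y\<in>W. ereal (p \<bullet> y - \<epsilon> * norm y - C) \<le> m y" by blast
next
  assume g: "\<forall>\<epsilon>>0. \<exists>C. \<forall>y\<in>W. ereal (p \<bullet> y - \<epsilon> * norm y - C) \<le> m y"
  show "0 \<le> Liminf ?F ?q"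
    unfolding le_Liminf_iff
  proof (intro allI impI)
    fix r :: ereal assume "r < 0"
    then obtain s where s: "r < ereal s" "s < 0"
      using ereal_dense2[OF \<open>r < 0\<close>] by (auto simp: zero_ereal_def)
    define \<epsilon> where "\<epsilon> = - s / 2"
    have \<epsilon>: "\<epsilon> > 0" "s = - 2 * \<epsilon>" using s by (auto simp: \<epsilon>_def)
    then obtain C where C: "\<And>y. y \<in> W \<Longrightarrow> ereal (p \<bullet> y - \<epsilon> * norm y - C) \<le> m y"
      using g by blast
    define R where "R = max 1 (\<bar>C - p \<bullet> z\<bar> / \<epsilon>)"
    have "ereal s \<le> ?q y" if "R \<le> norm y" "y \<in> W" for y
    proof (cases "m y")
      case (real t)
      have "\<bar>C - p \<bullet> z\<bar> / \<epsilon> \<le> norm y" "1 \<le> norm y" using that by (simp_all add: R_def del: zero_less_norm_iff)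
      then have "\<bar>C - p \<bullet> z\<bar> \<le> \<epsilon> * norm y" using \<epsilon> by (simp add: field_simps)
      moreover have "norm y > 0" using \<open>1 \<le> norm y\<close> by (rule less_le_trans[OF zero_less_one])
      moreover have "p \<bullet> y - \<epsilon> * norm y - C \<le> t" using C[OF that(2)] real by simp
      ultimately have "s * norm y \<le> t - p \<bullet> (y - z)" using \<epsilon>(2) by (simp add: inner_diff_right)
      then have "s \<le> (t - p \<bullet> (y - z)) / norm y" using \<open>norm y > 0\<close> by (simp add: pos_le_divide_eq)
      then show ?thesis using real \<open>norm y > 0\<close> by simp
    next
      case PInf
      have "norm y > 0" using that(1) by (auto simp: R_def)
      then show ?thesis using PInf by simp
    qed (use m0[OF that(2)] in auto)
    then show "\<forall>\<^sub>F y in ?F. r < ?q y"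
      unfolding eventually_inf_principal eventually_at_infinity
      by (intro exI[of _ R] allI impI less_le_trans[OF s(1)])
  qed
qed

section \<open>One realisation: chains bound subsolutions\<close>

locale positive_component =
  fixes A :: "real ^ 'n \<Rightarrow> real" and U :: "(real ^ 'n) set" and \<delta>b :: "real \<Rightarrow> real" and \<eta>0 :: real
  assumes continuous: "continuous_on UNIV A"
    and component: "U \<in> components {x. A x > 0}"
    and threshold: "admissible_threshold \<delta>b \<eta>0"
begin

lemma open_U: "open U"
  using component continuous by (rule_tac open_components) (auto intro: open_Collect_less)

lemma U_nonempty: "U \<noteq> {}"
  using component by (rule in_components_nonempty)

lemma positive: "x \<in> U \<Longrightarrow> A x > 0"
  using in_components_subset[OF component] by auto

lemma ball_subset:
  assumes "x \<in> U" and "\<And>u. u \<in> ball x r \<Longrightarrow> A u > 0"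
  shows "ball x r \<subseteq> U"
proof (cases "r > 0")
  case True
  then have "x \<in> U \<inter> ball x r" using assms(1) by simp
  moreover have "ball x r \<subseteq> {x. A x > 0}" using assms(2) by blast
  ultimately show ?thesis
    using components_maximal[OF component connected_ball] by blast
qed (simp add: ball_empty)

lemma open_superlevel: "open (superlevel A U \<delta>)"
proof -
  have "superlevel A U \<delta> = U \<inter> {x. \<delta> < \<bar>A x\<bar>}" by (auto simp: superlevel_def)
  then show ?thesis
    using open_U continuous by (auto intro!: open_Int open_Collect_less continuous_intros)
qed

lemma superlevel_iff: "x \<in> superlevel A U \<delta> \<longleftrightarrow> x \<in> U \<and> \<delta> < A x"
  using positive by (force simp: superlevel_def)

text \<open>Jump edges are instances of the defining bound of \<open>S_class\<close>. For the other
  kind, continuity and density of \<open>D\<close> extend the bound on \<open>A\<close> to the whole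
  ball, \<open>ball_subset\<close> puts the ball into \<open>U\<close>, and the viscosity inequality
  gives the slope.\<close>

lemma edge_bound:
  assumes w: "w \<in> subsolutions \<delta>b \<eta>0 A U \<mu>" and "\<mu> > 0" and dense: "closure D = UNIV"
    and e: "edge \<delta>b \<eta>0 A U D \<mu> \<kappa> x y"
  shows "w y - w x \<le> \<kappa> * dist x y"
proof -
  have U: "x \<in> U" "y \<in> U" using e by (auto simp: edge_def)
  from e consider (jump) \<eta> \<delta> where "0 < \<eta>" "\<eta> < \<eta>0" "0 < \<delta>" "\<delta> < \<delta>b \<eta>" "\<delta> < A x" "\<delta> < A y" "\<mu> / \<delta> + \<eta> \<le> \<kappa>"
    | (near) "\<forall>u\<in>D. dist x u < 2 * dist x y \<longrightarrow> 0 < A u \<and> \<mu> \<le> \<kappa> * A u"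
    unfolding edge_def by blast
  then show ?thesis
  proof cases
    case jump
    then have "\<bar>w x - w y\<bar> \<le> (\<mu> / \<delta> + \<eta>) * norm (x - y)"
      using w U by (simp add: subsolutions_def L_class_def S_class_def superlevel_iff)
    also have "\<dots> \<le> \<kappa> * norm (x - y)" using jump by (intro mult_right_mono) auto
    finally show ?thesis unfolding dist_norm by linarith
  next
    case near
    show ?thesis
    proof (cases "x = y")
      case False
      have *: "\<mu> \<le> \<kappa> * A u" if "u \<in> ball x (2 * dist x y)" for u
      proof (rule ge_on_open_from_dense[OF open_ball dense _ _ that])
        show "continuous_on UNIV (\<lambda>u. \<kappa> * A u)" using continuous by (intro continuous_intros)
        show "\<mu> \<le> \<kappa> * A u" if "u \<in> D \<inter> ball x (2 * dist x y)" for u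
          using near that by simp
      qed
      have "\<mu> \<le> \<kappa> * A x" using * False by simp
      then have "\<kappa> > 0" using positive[OF U(1)] \<open>\<mu> > 0\<close> by (metis less_le_trans zero_less_mult_pos2)
      have "A u > 0" if "u \<in> ball x (2 * dist x y)" for u
        using *[OF that] \<open>\<kappa> > 0\<close> \<open>\<mu> > 0\<close> by (metis less_le_trans zero_less_mult_pos)
      then have sub: "ball x (2 * dist x y) \<subseteq> U" using ball_subset U by blast
      obtain L where "L-lipschitz_on UNIV w"
        using w by (auto simp: subsolutions_def L_class_def lipschitz_functions_def)
      \<comment> \<open>The factor 2 in \<open>edge\<close> leaves room for a closed ball with
        \<open>y\<close> in its interior on which the bound on \<open>A\<close> is known.\<close>
      moreover have "cball x (3 / 2 * dist x y) \<subseteq> ball x (2 * dist x y)"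
      proof
        fix u assume "u \<in> cball x (3 / 2 * dist x y)"
        then have "dist x u \<le> 3 / 2 * dist x y" by simp
        moreover have "dist x y > 0" using False by simp
        ultimately show "u \<in> ball x (2 * dist x y)" unfolding mem_ball by linarith
      qed
      ultimately show ?thesis
        using w * sub \<open>\<kappa> > 0\<close> \<open>\<mu> > 0\<close> False
        by (intro viscosity_subsol_lipschitz_on_ball[of A U \<mu> w L x "3 / 2 * dist x y"])
          (auto simp: subsolutions_def)
    qed simp
  qed
qed

lemma chain_bound:
  assumes "w \<in> subsolutions \<delta>b \<eta>0 A U \<mu>" and "\<mu> > 0" and "closure D = UNIV"
  shows "chain \<delta>b \<eta>0 A U D \<mu> z n t y \<Longrightarrow> w y - w z \<le> t"
proof (induction n arbitrary: t y)
  case (Suc n)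
  then obtain x s \<kappa> where x: "chain \<delta>b \<eta>0 A U D \<mu> z n s x" "edge \<delta>b \<eta>0 A U D \<mu> \<kappa> x y"
    "s + \<kappa> * dist x y \<le> t"
    by auto
  then show ?case using edge_bound[OF assms x(2)] Suc.IH[OF x(1)] by linarith
qed auto

lemma chain_in_component: "chain \<delta>b \<eta>0 A U D \<mu> z n t y \<Longrightarrow> z \<in> U \<Longrightarrow> y \<in> U"
  by (cases n) (auto simp: edge_def)

text \<open>Two points of \<open>U\<close> lie in a common \<open>superlevel\<close> set for small
  \<open>\<delta>\<close>, so one jump joins them; hence chain distances are never infinite.\<close>

lemma jump_exists:
  assumes "x \<in> U" "y \<in> U"
  shows "\<exists>\<kappa>\<in>\<rat>. edge \<delta>b \<eta>0 A U D \<mu> \<kappa> x y"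
proof -
  define \<eta> where "\<eta> = \<eta>0 / 2"
  have \<eta>: "0 < \<eta>" "\<eta> < \<eta>0" "0 < \<delta>b \<eta>"
    using threshold by (auto simp: admissible_threshold_def \<eta>_def)
  obtain \<delta> where \<delta>: "0 < \<delta>" "\<delta> < min (\<delta>b \<eta>) (min (A x) (A y))"
    using dense[of 0 "min (\<delta>b \<eta>) (min (A x) (A y))"] \<eta> positive assms by auto
  obtain \<kappa> where "\<kappa> \<in> \<rat>" "\<mu> / \<delta> + \<eta> < \<kappa>" using Rats_dense_in_real[of "\<mu> / \<delta> + \<eta>" "\<mu> / \<delta> + \<eta> + 1"] by auto
  then show ?thesis using assms \<eta> \<delta> unfolding edge_def by (intro bexI[of _ \<kappa>]) fastforce+
qed

lemma zero_subsolution: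
  assumes "\<mu> > 0"
  shows "(\<lambda>_. 0) \<in> subsolutions \<delta>b \<eta>0 A U \<mu>"
proof -
  have "viscosity_subsol A U 0 \<mu> (\<lambda>_. 0)"
  proof (rule viscosity_subsol_if_local_slope[OF positive assms])
    fix x k assume "x \<in> U" "\<mu> < k * A x"
    then have "k > 0" using positive[of x] \<open>\<mu> > 0\<close> by (metis less_trans zero_less_mult_pos2)
    then show "\<exists>r>0. \<forall>y\<in>ball x r. 0 - 0 \<le> k * dist x y" by (auto intro: exI[of _ 1])
  qed
  moreover have "0-lipschitz_on UNIV (\<lambda>_::real ^ 'n. 0::real)" by (rule lipschitz_on_constant)
  ultimately show ?thesis
    using assms by (auto simp: subsolutions_def L_class_def S_class_def lipschitz_functions_def)
qed

lemma subsolutions_mono: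
  assumes "w \<in> subsolutions \<delta>b \<eta>0 A U \<mu>" "\<mu> \<le> \<mu>'"
  shows "w \<in> subsolutions \<delta>b \<eta>0 A U \<mu>'"
proof -
  have "w \<in> S_class \<delta>b \<eta>0 A U \<mu>'"
    unfolding S_class_def
  proof (clarify)
    fix \<eta> \<delta> y1 y2
    assume a: "0 < \<eta>" "\<eta> < \<eta>0" "0 < \<delta>" "\<delta> < \<delta>b \<eta>" "y1 \<in> superlevel A U \<delta>" "y2 \<in> superlevel A U \<delta>"
    then have "\<bar>w y1 - w y2\<bar> \<le> (\<mu> / \<delta> + \<eta>) * norm (y1 - y2)"
      using assms by (auto simp: subsolutions_def L_class_def S_class_def)
    also have "\<dots> \<le> (\<mu>' / \<delta> + \<eta>) * norm (y1 - y2)"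
      using a assms(2) by (intro mult_right_mono add_right_mono divide_right_mono) auto
    finally show "\<bar>w y1 - w y2\<bar> \<le> (\<mu>' / \<delta> + \<eta>) * norm (y1 - y2)" .
  qed
  moreover have "viscosity_subsol A U 0 \<mu>' w"
    using assms order_trans unfolding subsolutions_def viscosity_subsol_def by blast
  ultimately show ?thesis using assms by (auto simp: subsolutions_def L_class_def)
qed

text \<open>The tolerance \<open>\<eta>\<close> in \<open>S_class\<close> does not scale with the
  level, whence \<open>c \<le> 1\<close>. Scaling brings a subsolution of level slightly above
  \<open>\<mu>\<close> down to \<open>\<mu>\<close>, as \<open>hamiltonian_at_le_iff_Liminf\<close>
  requires.\<close>

lemma subsolutions_scale:
  assumes w: "w \<in> subsolutions \<delta>b \<eta>0 A U \<mu>'" and c: "0 < c" "c \<le> 1"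
  shows "(\<lambda>y. c * w y) \<in> subsolutions \<delta>b \<eta>0 A U (c * \<mu>')"
proof -
  have "viscosity_subsol A U 0 (c * \<mu>') (\<lambda>y. c * w y)"
    unfolding viscosity_subsol_def
  proof (intro allI ballI impI, elim conjE)
    fix \<phi> :: "real ^ 'n \<Rightarrow> real" and g x
    assume x: "x \<in> U" and der: "\<forall>y\<in>U. (\<phi> has_derivative (\<lambda>h. g y \<bullet> h)) (at y)"
      and g: "continuous_on U g" and max: "\<forall>\<^sub>F y in nhds x. c * w y - \<phi> y \<le> c * w x - \<phi> x"
    have "\<forall>y\<in>U. ((\<lambda>y. \<phi> y / c) has_derivative (\<lambda>h. (g y /\<^sub>R c) \<bullet> h)) (at y)"
      using der c by (auto intro!: derivative_eq_intros simp: divide_inverse mult.commute)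
    moreover have "continuous_on U (\<lambda>y. g y /\<^sub>R c)" using g by (intro continuous_intros)
    moreover have "\<forall>\<^sub>F y in nhds x. w y - \<phi> y / c \<le> w x - \<phi> x / c"
      using max proof eventually_elim
      case (elim y)
      then have "(c * w y - \<phi> y) / c \<le> (c * w x - \<phi> x) / c" using c by (intro divide_right_mono) auto
      then show ?case using c by (simp add: diff_divide_distrib)
    qed
    ultimately have "A x * norm (0 + g x /\<^sub>R c) \<le> \<mu>'"
      using viscosity_subsolD[of A U 0 \<mu>' w x "\<lambda>y. \<phi> y / c" "\<lambda>y. g y /\<^sub>R c"] w x
      by (simp add: subsolutions_def)
    then show "A x * norm (0 + g x) \<le> c * \<mu>'" using c by (simp add: field_simps)
  qed
  moreover have "(\<lambda>y. c * w y) \<in> lipschitz_functions"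
    using w c lipschitz_on_cmult_real_nonneg[of _ UNIV w c]
    by (auto simp: subsolutions_def L_class_def lipschitz_functions_def)
  moreover have "(\<lambda>y. c * w y) \<in> S_class \<delta>b \<eta>0 A U (c * \<mu>')"
    unfolding S_class_def
  proof (clarify)
    fix \<eta> \<delta> y1 y2
    assume a: "0 < \<eta>" "\<eta> < \<eta>0" "0 < \<delta>" "\<delta> < \<delta>b \<eta>" "y1 \<in> superlevel A U \<delta>" "y2 \<in> superlevel A U \<delta>"
    then have "\<bar>w y1 - w y2\<bar> \<le> (\<mu>' / \<delta> + \<eta>) * norm (y1 - y2)"
      using w by (auto simp: subsolutions_def L_class_def S_class_def)
    then have "c * \<bar>w y1 - w y2\<bar> \<le> c * ((\<mu>' / \<delta> + \<eta>) * norm (y1 - y2))"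
      using c by (intro mult_left_mono) auto
    also have "\<dots> \<le> (c * \<mu>' / \<delta> + \<eta>) * norm (y1 - y2)"
      using c a mult_left_le_one_le[of \<eta> c] by (simp add: distrib_left mult.assoc[symmetric] mult_right_mono)
    finally show "\<bar>c * w y1 - c * w y2\<bar> \<le> (c * \<mu>' / \<delta> + \<eta>) * norm (y1 - y2)"
      using c by (simp add: right_diff_distrib[symmetric] abs_mult)
  qed
  ultimately show ?thesis by (simp add: subsolutions_def L_class_def)
qed

lemma edge_superlevel:
  assumes "0 < \<eta>" "\<eta> < \<eta>0" "0 < \<delta>" "\<delta> < \<delta>b \<eta>" "\<delta> \<le> \<delta>'"
    and "x \<in> superlevel A U \<delta>'" "y \<in> superlevel A U \<delta>'"
  shows "edge \<delta>b \<eta>0 A U D \<mu> (\<mu> / \<delta> + \<eta>) x y"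
  using assms unfolding superlevel_iff edge_def by (meson le_less_trans order_refl)

section \<open>From chain distances to a subsolution\<close>

text \<open>The constructed \<open>v\<close> depends on \<open>\<epsilon>0\<close> but not on
  \<open>\<epsilon>\<close>, so one function serves all smaller error slopes at once. The gap
  between \<open>\<mu>\<close> and \<open>\<mu>'\<close> pays for the additive \<open>\<eta>\<close>
  in the slope \<open>\<mu> / \<delta> + \<eta>\<close> of the extension.\<close>

lemma subsolution_from_chains:
  assumes dense: "closure D = UNIV" and z: "z \<in> D" "z \<in> U" and \<mu>: "0 < \<mu>" "\<mu> < \<mu>'" and "0 < \<epsilon>0"
    and growth0: "chain_growth \<delta>b \<eta>0 A U D \<mu> p \<epsilon>0 z"
  shows "\<exists>v\<in>subsolutions \<delta>b \<eta>0 A U \<mu>'. \<forall>\<epsilon>. 0 \<le> \<epsilon> \<and> \<epsilon> \<le> \<epsilon>0 \<and> chain_growth \<delta>b \<eta>0 A U D \<mu> p \<epsilon> z \<longrightarrow>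
           growth_bound v p \<epsilon>"
proof -
  define T where "T = (\<lambda>y. {t \<in> \<rat>. \<exists>n. chain \<delta>b \<eta>0 A U D \<mu> z n t y})"
  define d where "d = (\<lambda>y. Inf (T y))"
  have T_lower: "\<exists>C. \<forall>y\<in>D. \<forall>t\<in>T y. p \<bullet> y - \<epsilon> * norm y - C \<le> t"
    if "chain_growth \<delta>b \<eta>0 A U D \<mu> p \<epsilon> z" for \<epsilon>
    using that unfolding chain_growth_def T_def by blast
  have bdd: "bdd_below (T y)" if "y \<in> D" for y
  proof -
    obtain C where "\<forall>y\<in>D. \<forall>t\<in>T y. p \<bullet> y - \<epsilon>0 * norm y - C \<le> t" using T_lower[OF growth0] by blast
    then show ?thesis using that by (intro bdd_belowI[where m = "p \<bullet> y - \<epsilon>0 * norm y - C"]) blast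
  qed
  have nonempty: "T y \<noteq> {}" if yD: "y \<in> D" and yU: "y \<in> U" for y
  proof -
    obtain \<kappa> where \<kappa>: "\<kappa> \<in> \<rat>" "edge \<delta>b \<eta>0 A U D \<mu> \<kappa> z y" using jump_exists[OF z(2) yU] by blast
    obtain t where "t \<in> \<rat>" "\<kappa> * dist z y < t"
      using Rats_dense_in_real[of "\<kappa> * dist z y" "\<kappa> * dist z y + 1"] by auto
    then have "chain \<delta>b \<eta>0 A U D \<mu> z (Suc 0) t y"
      unfolding chain.simps(2)
      using z \<kappa> by (intro bexI[of _ z] bexI[of _ "0::real"] rev_bexI[of \<kappa>]) auto
    then show ?thesis using \<open>t \<in> \<rat>\<close> unfolding T_def by blast
  qed
  have d_edge: "d y \<le> d x + \<kappa> * dist x y"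
    if x: "x \<in> D" and y: "y \<in> D" and e: "edge \<delta>b \<eta>0 A U D \<mu> \<kappa> x y" for x y \<kappa>
  proof (rule field_le_epsilon)
    fix e :: real assume "0 < e"
    have "x \<in> U" using e by (auto simp: edge_def)
    then obtain s where s: "s \<in> T x" "s < d x + e / 3"
      using cInf_lessD[OF nonempty[OF x], of "d x + e / 3"] \<open>0 < e\<close> unfolding d_def by auto
    \<comment> \<open>Weight and time are rounded up to rationals at a cost of \<open>e / 3\<close>
      each, next to \<open>e / 3\<close> from the infimum; the summand 1 avoids division by zero
      when \<open>x = y\<close>.\<close>
    have "0 < e / (3 * (dist x y + 1))" using \<open>0 < e\<close> by (simp add: add_nonneg_pos)
    then obtain \<kappa>' where \<kappa>': "\<kappa>' \<in> \<rat>" "\<kappa> < \<kappa>'" "\<kappa>' < \<kappa> + e / (3 * (dist x y + 1))"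
      using Rats_dense_in_real[of \<kappa> "\<kappa> + e / (3 * (dist x y + 1))"] by auto
    have "\<kappa>' * dist x y \<le> (\<kappa> + e / (3 * (dist x y + 1))) * dist x y"
      using \<kappa>' by (intro mult_right_mono) auto
    also have "\<dots> = \<kappa> * dist x y + e / 3 * (dist x y / (dist x y + 1))"
      by (simp add: distrib_right)
    also have "\<dots> \<le> \<kappa> * dist x y + e / 3"
      using \<open>0 < e\<close> by (simp add: divide_le_eq add_nonneg_pos)
    finally have k: "\<kappa>' * dist x y \<le> \<kappa> * dist x y + e / 3" .
    obtain t where t: "t \<in> \<rat>" "s + \<kappa>' * dist x y < t" "t < s + \<kappa>' * dist x y + e / 3"
      using Rats_dense_in_real[of "s + \<kappa>' * dist x y" "s + \<kappa>' * dist x y + e / 3"] \<open>0 < e\<close> by auto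
    obtain n where "chain \<delta>b \<eta>0 A U D \<mu> z n s x" "s \<in> \<rat>" using s by (auto simp: T_def)
    then have "chain \<delta>b \<eta>0 A U D \<mu> z (Suc n) t y"
      using x t(2) \<kappa>'(1) edge_mono[OF e, of \<kappa>'] \<kappa>'(2) unfolding chain.simps
      by (meson less_imp_le)
    then have "t \<in> T y" using t unfolding T_def by blast
    then have "d y \<le> t" unfolding d_def by (rule cInf_lower[OF _ bdd[OF y]])
    then show "d y \<le> d x + \<kappa> * dist x y + e" using t s k by linarith
  qed
  define \<eta> where "\<eta> = \<eta>0 / 2"
  have \<eta>: "0 < \<eta>" "\<eta> < \<eta>0" "0 < \<delta>b \<eta>"
    using threshold by (auto simp: admissible_threshold_def \<eta>_def)
  have pe: "norm p + \<epsilon>0 > 0" using \<open>0 < \<epsilon>0\<close> by (simp add: add_nonneg_pos)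
  \<comment> \<open>Four demands on \<open>\<delta>\<close>: jumps at height \<open>\<delta>\<close>
    are admissible, \<open>z\<close> lies in the superlevel set,
    \<open>K * \<delta> \<le> \<mu>'\<close>, and \<open>K\<close> is at least
    \<open>norm p + \<epsilon>0\<close>.\<close>
  have "0 < min (min (\<delta>b \<eta>) (A z)) (min ((\<mu>' - \<mu>) / \<eta>) (\<mu> / (norm p + \<epsilon>0)))"
    using \<eta> positive z \<mu> pe by auto
  then obtain \<delta> where \<delta>: "0 < \<delta>" "\<delta> < min (min (\<delta>b \<eta>) (A z)) (min ((\<mu>' - \<mu>) / \<eta>) (\<mu> / (norm p + \<epsilon>0)))"
    using Orderings.dense by blast
  define K where "K = \<mu> / \<delta> + \<eta>"
  have K_large: "norm p + \<epsilon>0 \<le> K"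
  proof -
    have "\<delta> < \<mu> / (norm p + \<epsilon>0)" using \<delta> by simp
    then have "norm p + \<epsilon>0 < \<mu> / \<delta>" using pe \<delta>(1) by (simp add: field_simps)
    then show ?thesis using \<eta> by (simp add: K_def)
  qed
  then have K0: "K > 0" using pe by linarith
  have K_small: "K * \<delta> \<le> \<mu>'"
  proof -
    have "\<delta> < (\<mu>' - \<mu>) / \<eta>" using \<delta> by simp
    then have "\<eta> * \<delta> < \<mu>' - \<mu>" using \<eta> by (simp add: field_simps)
    then show ?thesis using \<delta>(1) by (simp add: K_def distrib_right)
  qed
  define S where "S = D \<inter> superlevel A U \<delta>"
  have S: "z \<in> S" using z \<delta> by (simp add: S_def superlevel_iff)
  have SD: "y \<in> D" "y \<in> U" if "y \<in> S" for y using that by (auto simp: S_def superlevel_iff)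
  have d_lip: "d y \<le> d x + K * dist x y" if "x \<in> S" "y \<in> S" for x y
  proof (rule d_edge)
    show "edge \<delta>b \<eta>0 A U D \<mu> K x y"
      using that \<eta> \<delta> unfolding K_def by (intro edge_superlevel[of _ _ \<delta>]) (auto simp: S_def)
  qed (use that SD in auto)
  \<comment> \<open>Growth survives the extension because a cone of slope \<open>K\<close> rises at
    least as fast as \<open>p \<bullet> x - \<epsilon> * norm x\<close> can vary.\<close>
  have lower: "\<exists>C. \<forall>x. \<forall>y\<in>S. p \<bullet> x - \<epsilon> * norm x - C \<le> d y + K * dist x y"
    if g: "chain_growth \<delta>b \<eta>0 A U D \<mu> p \<epsilon> z" and \<epsilon>: "0 \<le> \<epsilon>" "\<epsilon> \<le> \<epsilon>0" for \<epsilon>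
  proof -
    obtain C where C: "\<forall>y\<in>D. \<forall>t\<in>T y. p \<bullet> y - \<epsilon> * norm y - C \<le> t" using T_lower[OF g] by blast
    have "p \<bullet> x - \<epsilon> * norm x - C \<le> d y + K * dist x y" if "y \<in> S" for x y
    proof -
      have "p \<bullet> y - \<epsilon> * norm y - C \<le> d y"
        unfolding d_def using C SD[OF that] nonempty by (intro cInf_greatest) auto
      moreover have "p \<bullet> (x - y) \<le> norm p * norm (x - y)" by (rule norm_cauchy_schwarz)
      moreover have "\<epsilon> * norm y \<le> \<epsilon> * (norm x + norm (x - y))"
        using \<epsilon> norm_triangle_sub[of y x] by (intro mult_left_mono) (auto simp: norm_minus_commute)
      moreover have "(norm p + \<epsilon>) * norm (x - y) \<le> K * norm (x - y)"
        using K_large \<epsilon> by (intro mult_right_mono) auto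
      ultimately show ?thesis by (simp add: dist_norm algebra_simps)
    qed
    then show ?thesis by blast
  qed
  obtain C0 where C0: "\<forall>x. \<forall>y\<in>S. p \<bullet> x - \<epsilon>0 * norm x - C0 \<le> d y + K * dist x y"
    using lower[OF growth0] \<open>0 < \<epsilon>0\<close> by auto
  \<comment> \<open>McShane extension of \<open>d\<close> from \<open>S\<close>, where jump edges
    make \<open>d\<close> Lipschitz with constant \<open>K\<close>.\<close>
  define v where "v = (\<lambda>x. INF y\<in>S. d y + K * dist x y)"
  have v_le: "v x \<le> d y + K * dist x y" if "y \<in> S" for x y
    unfolding v_def using C0 that by (intro cINF_lower bdd_belowI2[where m = "p \<bullet> x - \<epsilon>0 * norm x - C0"]) auto
  have v_ge: "c \<le> v x" if "\<And>y. y \<in> S \<Longrightarrow> c \<le> d y + K * dist x y" for c x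
    unfolding v_def using S that by (intro cINF_greatest) auto
  have v_eq: "v x = d x" if "x \<in> S" for x
    using v_le[OF that, of x] v_ge[of "d x" x] d_lip that by (fastforce simp: dist_commute)
  have v_lip: "v x - v x' \<le> K * dist x x'" for x x'
  proof -
    have "v x - K * dist x x' \<le> v x'"
    proof (rule v_ge)
      fix y assume "y \<in> S"
      have "K * dist x y \<le> K * (dist x x' + dist x' y)"
        using K0 by (intro mult_left_mono dist_triangle) auto
      then show "v x - K * dist x x' \<le> d y + K * dist x' y"
        using v_le[OF \<open>y \<in> S\<close>, of x] by (simp add: distrib_left)
    qed
    then show ?thesis by simp
  qed
  have lip: "K-lipschitz_on UNIV v"
  proof (rule lipschitz_onI)
    show "dist (v x) (v x') \<le> K * dist x x'" for x x'
      using v_lip[of x x'] v_lip[of x' x] unfolding dist_real_def dist_commute[of x' x] by linarith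
  qed (use K0 in auto)
  then have cont: "continuous_on UNIV v" by (rule lipschitz_on_continuous_on)
  have "v \<in> S_class \<delta>b \<eta>0 A U \<mu>'"
    unfolding S_class_def
  proof clarify
    fix \<eta>' \<delta>' y1 y2
    assume a: "0 < \<eta>'" "\<eta>' < \<eta>0" "0 < \<delta>'" "\<delta>' < \<delta>b \<eta>'"
      and y: "y1 \<in> superlevel A U \<delta>'" "y2 \<in> superlevel A U \<delta>'"
    \<comment> \<open>For \<open>\<delta> \<le> \<delta>'\<close>, \<open>v\<close> equals the chain
      distance at the points of \<open>D\<close> concerned, and jumps with the given
      \<open>\<eta>'\<close> and \<open>\<delta>'\<close> apply. For smaller
      \<open>\<delta>'\<close> the allowed slope is already at least \<open>K\<close>.\<close>
    have "v y - v x \<le> (\<mu>' / \<delta>' + \<eta>') * dist x y"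
      if "x \<in> superlevel A U \<delta>'" "y \<in> superlevel A U \<delta>'" for x y
    proof (cases "\<delta> \<le> \<delta>'")
      case True
      have "v y - v x \<le> (\<mu> / \<delta>' + \<eta>') * dist x y"
      proof (rule lipschitz_bound_from_dense[OF open_superlevel dense cont _ that])
        fix x y assume xy: "x \<in> D \<inter> superlevel A U \<delta>'" "y \<in> D \<inter> superlevel A U \<delta>'"
        then have "edge \<delta>b \<eta>0 A U D \<mu> (\<mu> / \<delta>' + \<eta>') x y"
          using a by (intro edge_superlevel[of _ _ \<delta>']) auto
        moreover have "x \<in> S" "y \<in> S" using xy True by (auto simp: S_def superlevel_iff)
        ultimately show "v y - v x \<le> (\<mu> / \<delta>' + \<eta>') * dist x y"
          using d_edge[of x y "\<mu> / \<delta>' + \<eta>'"] SD by (simp add: v_eq)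
      qed
      also have "\<dots> \<le> (\<mu>' / \<delta>' + \<eta>') * dist x y"
        using \<mu> a by (intro mult_right_mono add_right_mono divide_right_mono) auto
      finally show ?thesis .
    next
      case False
      have "K \<le> \<mu>' / \<delta>" using K_small \<delta>(1) by (simp add: field_simps)
      also have "\<dots> \<le> \<mu>' / \<delta>'" using False a \<mu> by (intro divide_left_mono) auto
      also have "\<dots> \<le> \<mu>' / \<delta>' + \<eta>'" using a by simp
      finally have "K * dist y x \<le> (\<mu>' / \<delta>' + \<eta>') * dist y x" by (intro mult_right_mono) auto
      then show ?thesis using v_lip[of y x] by (simp add: dist_commute)
    qed
    from this[OF y] this[OF y(2) y(1)]
    show "\<bar>v y1 - v y2\<bar> \<le> (\<mu>' / \<delta>' + \<eta>') * norm (y1 - y2)"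
      unfolding dist_norm norm_minus_commute[of y2 y1] by linarith
  qed
  moreover have "viscosity_subsol A U 0 \<mu>' v"
  proof (rule viscosity_subsol_if_local_slope[OF positive])
    fix x k assume x: "x \<in> U" and k: "\<mu>' < k * A x"
    have Ax: "A x > 0" using positive x .
    have "0 < k * A x" using k \<mu> by linarith
    then have k0: "k > 0" using Ax by (rule zero_less_mult_pos2)
    show "\<exists>r>0. \<forall>y\<in>ball x r. v x - v y \<le> k * dist x y"
    proof (cases "\<delta> < A x")
      case True
      \<comment> \<open>Where \<open>A x > \<delta>\<close>, \<open>v\<close> agrees with
        \<open>d\<close> at the points of \<open>D\<close> near \<open>x\<close>, so the non-jump
        edges control its slope.\<close>
      let ?W = "superlevel A U \<delta> \<inter> {u. \<mu> < k * A u}"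
      have "open ?W"
        using continuous by (intro open_Int open_superlevel open_Collect_less continuous_intros)
      moreover have "x \<in> ?W" using x True k \<mu> by (simp add: superlevel_iff)
      ultimately obtain R where R: "R > 0" "ball x R \<subseteq> ?W" by (rule openE)
      \<comment> \<open>For \<open>y\<close> and \<open>y'\<close> within \<open>r\<close> of
        \<open>x\<close>, points closer to \<open>y'\<close> than \<open>2 * dist y' y\<close> are
        within \<open>r + 4 * r = R\<close> of \<open>x\<close>.\<close>
      define r where "r = R / 5"
      have r: "r > 0" "R = 5 * r" using R by (auto simp: r_def)
      have near: "v y - v y' \<le> k * dist y' y" if y: "y' \<in> D \<inter> ball x r" "y \<in> D \<inter> ball x r" for y y'
      proof -
        have "y \<in> ball x R" "y' \<in> ball x R" using y r by auto
        then have S': "y \<in> S" "y' \<in> S" using y R by (auto simp: S_def)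
        have "0 < A u \<and> \<mu> \<le> k * A u" if "dist y' u < 2 * dist y' y" for u
        proof -
          have "dist y' y < 2 * r" using y dist_triangle[of y' y x] by (simp add: dist_commute)
          then have "dist x u < R" using that y dist_triangle[of x u y'] r by simp
          then have "u \<in> ?W" using R by auto
          then show ?thesis using \<delta>(1) by (auto simp: superlevel_iff)
        qed
        then have "edge \<delta>b \<eta>0 A U D \<mu> k y' y"
          using S' SD unfolding edge_def by blast
        then show ?thesis using d_edge[of y' y k] SD S' by (simp add: v_eq)
      qed
      have "v x - v y \<le> k * dist y x" if "y \<in> ball x r" for y
        using lipschitz_bound_from_dense[OF open_ball dense cont near that, of x] r by simp
      then show ?thesis using r by (auto simp: dist_commute)
    next
      case False
      \<comment> \<open>Where \<open>A x \<le> \<delta>\<close>, even the steep slope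
        \<open>K\<close> is allowed, since \<open>K * \<delta> \<le> \<mu>'\<close>.\<close>
      have "K * A x \<le> K * \<delta>" using False K0 by (intro mult_left_mono) auto
      then have "K * A x < k * A x" using K_small k by linarith
      then have "K < k" using Ax by simp
      then have "v x - v y \<le> k * dist x y" for y
        using v_lip[of x y] mult_right_mono[of K k "dist x y"] by simp
      then show ?thesis by (auto intro: exI[of _ 1])
    qed
  qed (use \<mu> in auto)
  moreover have "v \<in> lipschitz_functions" using lip by (auto simp: lipschitz_functions_def)
  ultimately have "v \<in> subsolutions \<delta>b \<eta>0 A U \<mu>'" by (simp add: subsolutions_def L_class_def)
  moreover have "growth_bound v p \<epsilon>"
    if "0 \<le> \<epsilon>" "\<epsilon> \<le> \<epsilon>0" "chain_growth \<delta>b \<eta>0 A U D \<mu> p \<epsilon> z" for \<epsilon>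
    using lower[OF that(3,1,2)] v_ge unfolding growth_bound_def by blast
  ultimately show ?thesis by blast
qed

section \<open>The Hamiltonian of one realisation as a growth condition\<close>

text \<open>Substituting \<open>v y = w y + p \<bullet> y\<close> turns the defining condition into
  the existence of a subsolution with growth \<open>p\<close>. Admissible levels are upward closed,
  but the infimum need not be attained, whence the levels above \<open>\<mu>\<close>.\<close>

lemma hamiltonian_at_le_iff:
  assumes "\<mu> > 0"
  shows "hamiltonian_at \<delta>b \<eta>0 A U p \<le> ereal \<mu> \<longleftrightarrow>
    (\<forall>\<mu>'>\<mu>. \<exists>v\<in>subsolutions \<delta>b \<eta>0 A U \<mu>'. \<forall>\<epsilon>>0. growth_bound v p \<epsilon>)"
proof -
  have growth: "growth_bound (\<lambda>y. w y + p \<bullet> y) p \<epsilon> \<longleftrightarrow> growth_bound w 0 \<epsilon>" for w \<epsilon>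
  proof -
    have "p \<bullet> y - \<epsilon> * norm y - C \<le> w y + p \<bullet> y \<longleftrightarrow> 0 \<bullet> y - \<epsilon> * norm y - C \<le> w y" for y C by simp
    then show ?thesis unfolding growth_bound_def by blast
  qed
  have lip_inner: "(\<lambda>y. q \<bullet> y) \<in> lipschitz_functions" for q :: "real ^ 'n"
    unfolding lipschitz_functions_def
    using Cauchy_Schwarz_ineq2[of q]
    by (auto intro!: exI[of _ "norm q"] lipschitz_onI simp: dist_norm inner_diff_right[symmetric])
  have lip_add: "(\<lambda>y. f y + g y) \<in> lipschitz_functions"
    if "f \<in> lipschitz_functions" "g \<in> lipschitz_functions" for f g :: "real ^ 'n \<Rightarrow> real"
    using that lipschitz_on_add unfolding lipschitz_functions_def by blast
  define E where "E = (\<lambda>\<mu>. \<exists>v\<in>subsolutions \<delta>b \<eta>0 A U \<mu>. \<forall>\<epsilon>>0. growth_bound v p \<epsilon>)"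
  have eq: "(\<exists>w\<in>S_plus. (\<lambda>y. w y + p \<bullet> y) \<in> L_class \<delta>b \<eta>0 A U \<mu> \<and> viscosity_subsol A U p \<mu> w) \<longleftrightarrow> E \<mu>" for \<mu>
  proof
    assume "\<exists>w\<in>S_plus. (\<lambda>y. w y + p \<bullet> y) \<in> L_class \<delta>b \<eta>0 A U \<mu> \<and> viscosity_subsol A U p \<mu> w"
    then obtain w where w: "w \<in> S_plus" "(\<lambda>y. w y + p \<bullet> y) \<in> L_class \<delta>b \<eta>0 A U \<mu>" "viscosity_subsol A U p \<mu> w"
      by blast
    have "viscosity_subsol A U 0 \<mu> (\<lambda>y. w y + p \<bullet> y)"
      using w(3) by (rule viscosity_subsol_shift[THEN iffD1])
    then have "(\<lambda>y. w y + p \<bullet> y) \<in> subsolutions \<delta>b \<eta>0 A U \<mu>" using w(2) by (simp add: subsolutions_def)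
    moreover have "\<forall>\<epsilon>>0. growth_bound (\<lambda>y. w y + p \<bullet> y) p \<epsilon>" using w(1) by (simp add: growth S_plus_iff)
    ultimately show "E \<mu>" unfolding E_def by blast
  next
    assume "E \<mu>"
    then obtain v where v: "v \<in> subsolutions \<delta>b \<eta>0 A U \<mu>" "\<forall>\<epsilon>>0. growth_bound v p \<epsilon>" unfolding E_def by blast
    define w where "w = (\<lambda>y. v y + (- p) \<bullet> y)"
    have vw: "v = (\<lambda>y. w y + p \<bullet> y)" by (simp add: w_def)
    have "v \<in> lipschitz_functions" using v by (simp add: subsolutions_def L_class_def)
    then have "w \<in> lipschitz_functions" unfolding w_def by (intro lip_add lip_inner)
    moreover have "\<forall>\<epsilon>>0. growth_bound w 0 \<epsilon>" using v(2) unfolding vw growth .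
    ultimately have "w \<in> S_plus" by (simp add: S_plus_iff)
    moreover have L: "(\<lambda>y. w y + p \<bullet> y) \<in> L_class \<delta>b \<eta>0 A U \<mu>" and vs: "viscosity_subsol A U 0 \<mu> (\<lambda>y. w y + p \<bullet> y)"
      using v(1) unfolding vw subsolutions_def by auto
    moreover have "viscosity_subsol A U p \<mu> w" using vs by (rule viscosity_subsol_shift[THEN iffD2])
    ultimately show "\<exists>w\<in>S_plus. (\<lambda>y. w y + p \<bullet> y) \<in> L_class \<delta>b \<eta>0 A U \<mu> \<and> viscosity_subsol A U p \<mu> w"
      by blast
  qed
  have ham: "hamiltonian_at \<delta>b \<eta>0 A U p = Inf (ereal ` {\<mu>. \<mu> > 0 \<and> E \<mu>})"
    unfolding hamiltonian_at_def eq ..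
  have mono: "E \<mu> \<Longrightarrow> \<mu> \<le> \<mu>' \<Longrightarrow> E \<mu>'" for \<mu> \<mu>'
    using subsolutions_mono unfolding E_def by blast
  have "Inf (ereal ` {\<mu>. \<mu> > 0 \<and> E \<mu>}) \<le> ereal \<mu> \<longleftrightarrow> (\<forall>\<mu>'>\<mu>. E \<mu>')"
  proof
    assume "Inf (ereal ` {\<mu>. \<mu> > 0 \<and> E \<mu>}) \<le> ereal \<mu>"
    then have "Inf (ereal ` {\<mu>. \<mu> > 0 \<and> E \<mu>}) < ereal \<mu>'" if "\<mu> < \<mu>'" for \<mu>'
      using that by (meson le_less_trans less_ereal.simps(1))
    then show "\<forall>\<mu>'>\<mu>. E \<mu>'" using mono by (fastforce simp: Inf_less_iff)
  next
    assume E: "\<forall>\<mu>'>\<mu>. E \<mu>'"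
    show "Inf (ereal ` {\<mu>. \<mu> > 0 \<and> E \<mu>}) \<le> ereal \<mu>"
    proof (rule dense_ge)
      fix r assume "ereal \<mu> < r"
      then obtain \<mu>' where \<mu>': "ereal \<mu> < ereal \<mu>'" "ereal \<mu>' < r" using ereal_dense2 by blast
      then have "\<mu>' \<in> {\<mu>. \<mu> > 0 \<and> E \<mu>}" using E assms by simp
      then have "Inf (ereal ` {\<mu>. \<mu> > 0 \<and> E \<mu>}) \<le> ereal \<mu>'" by (intro Inf_lower imageI)
      then show "Inf (ereal ` {\<mu>. \<mu> > 0 \<and> E \<mu>}) \<le> r" using \<mu>' by (meson less_imp_le order_trans)
    qed
  qed
  then show ?thesis unfolding ham E_def .
qed

lemma hamiltonian_at_nonneg: "0 \<le> hamiltonian_at \<delta>b \<eta>0 A U p"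
  unfolding hamiltonian_at_def by (rule Inf_greatest) auto

text \<open>A subsolution bounds chains over every dense \<open>D\<close> and from every
  \<open>z\<close>, with \<open>v z\<close> entering only the constant. This allows the dense set
  and the base point to be exchanged.\<close>

lemma chain_growth_if_growth_bound:
  assumes v: "v \<in> subsolutions \<delta>b \<eta>0 A U \<mu>" and "\<mu> > 0" and "closure D = UNIV" and "growth_bound v p \<epsilon>"
  shows "chain_growth \<delta>b \<eta>0 A U D \<mu> p \<epsilon> z"
proof -
  obtain C where C: "\<forall>y. p \<bullet> y - \<epsilon> * norm y - C \<le> v y" using assms(4) by (auto simp: growth_bound_def)
  obtain N :: nat where N: "C + v z \<le> N" using real_arch_simple by blast
  have "p \<bullet> y - \<epsilon> * norm y - N \<le> t" if "chain \<delta>b \<eta>0 A U D \<mu> z n t y" for n t y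
    using chain_bound[OF assms(1-3) that] C[rule_format, of y] N by linarith
  then show ?thesis unfolding chain_growth_def by blast
qed

text \<open>Subsolutions bound chains of the same level. The converse construction loses a little in
  the level, which the quantifier over \<open>\<mu>' > \<mu>\<close> hides.\<close>

lemma hamiltonian_at_le_iff_chain_growth:
  assumes "\<mu> > 0" and dense: "closure D = UNIV" and z: "z \<in> D" "z \<in> U"
  shows "hamiltonian_at \<delta>b \<eta>0 A U p \<le> ereal \<mu> \<longleftrightarrow>
    (\<forall>\<mu>'>\<mu>. \<forall>\<epsilon>>0. chain_growth \<delta>b \<eta>0 A U D \<mu>' p \<epsilon> z)"
  unfolding hamiltonian_at_le_iff[OF assms(1)]
proof (intro iffI allI impI)
  fix \<mu>' \<epsilon> :: real assume "\<forall>\<mu>'>\<mu>. \<exists>v\<in>subsolutions \<delta>b \<eta>0 A U \<mu>'. \<forall>\<epsilon>>0. growth_bound v p \<epsilon>"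
    and "\<mu> < \<mu>'" "0 < \<epsilon>"
  then obtain v where "v \<in> subsolutions \<delta>b \<eta>0 A U \<mu>'" "growth_bound v p \<epsilon>" by blast
  then show "chain_growth \<delta>b \<eta>0 A U D \<mu>' p \<epsilon> z"
    using chain_growth_if_growth_bound dense \<open>\<mu> < \<mu>'\<close> \<open>\<mu> > 0\<close> less_trans by blast
next
  fix \<mu>' assume g: "\<forall>\<mu>'>\<mu>. \<forall>\<epsilon>>0. chain_growth \<delta>b \<eta>0 A U D \<mu>' p \<epsilon> z" and "\<mu> < \<mu>'"
  obtain \<nu> where \<nu>: "\<mu> < \<nu>" "\<nu> < \<mu>'" using Orderings.dense[OF \<open>\<mu> < \<mu>'\<close>] by blast
  then have "0 < \<nu>" using assms(1) by linarith
  have "chain_growth \<delta>b \<eta>0 A U D \<nu> p 1 z" using g \<nu> by simp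
  from subsolution_from_chains[OF dense z \<open>0 < \<nu>\<close> \<nu>(2) zero_less_one this]
  obtain v where v: "v \<in> subsolutions \<delta>b \<eta>0 A U \<mu>'"
    and gb: "\<forall>\<epsilon>. 0 \<le> \<epsilon> \<and> \<epsilon> \<le> 1 \<and> chain_growth \<delta>b \<eta>0 A U D \<nu> p \<epsilon> z \<longrightarrow> growth_bound v p \<epsilon>" by blast
  have "growth_bound v p \<epsilon>" if "\<epsilon> > 0" for \<epsilon>
  proof -
    \<comment> \<open>The construction was run with \<open>\<epsilon>0 = 1\<close>, so larger
      \<open>\<epsilon>\<close> are reduced to 1.\<close>
    have "growth_bound v p (min \<epsilon> 1)" using gb g \<nu>(1) that by simp
    then obtain C where C: "\<forall>y. p \<bullet> y - min \<epsilon> 1 * norm y - C \<le> v y" by (auto simp: growth_bound_def)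
    have "p \<bullet> y - \<epsilon> * norm y - C \<le> v y" for y
      using C[rule_format, of y] mult_right_mono[of "min \<epsilon> 1" \<epsilon> "norm y"] by simp
    then show ?thesis unfolding growth_bound_def by blast
  qed
  then show "\<exists>v\<in>subsolutions \<delta>b \<eta>0 A U \<mu>'. \<forall>\<epsilon>>0. growth_bound v p \<epsilon>" using v by blast
qed

section \<open>The maximal subsolution and its growth\<close>

lemma subsolutions_diff_const:
  assumes w: "w \<in> subsolutions \<delta>b \<eta>0 A U \<mu>"
  shows "(\<lambda>y. w y - c) \<in> subsolutions \<delta>b \<eta>0 A U \<mu>"
proof -
  have "viscosity_subsol A U 0 \<mu> (\<lambda>y. w y - c)"
    unfolding viscosity_subsol_def
  proof (intro allI ballI impI, elim conjE)
    fix \<phi> :: "real ^ 'n \<Rightarrow> real" and g x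
    assume x: "x \<in> U" and der: "\<forall>y\<in>U. (\<phi> has_derivative (\<lambda>h. g y \<bullet> h)) (at y)"
      and g: "continuous_on U g" and "\<forall>\<^sub>F y in nhds x. w y - c - \<phi> y \<le> w x - c - \<phi> x"
    then have "\<forall>\<^sub>F y in nhds x. w y - \<phi> y \<le> w x - \<phi> x" by (auto elim: eventually_mono)
    moreover have "viscosity_subsol A U 0 \<mu> w" using w by (simp add: subsolutions_def)
    ultimately show "A x * norm (0 + g x) \<le> \<mu>" by (intro viscosity_subsolD[OF _ x der g])
  qed
  moreover have "(\<lambda>y. w y - c) \<in> lipschitz_functions"
    using w by (auto simp: subsolutions_def L_class_def lipschitz_functions_def lipschitz_on_def dist_real_def)
  moreover have "(\<lambda>y. w y - c) \<in> S_class \<delta>b \<eta>0 A U \<mu>"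
    using w by (auto simp: subsolutions_def L_class_def S_class_def)
  ultimately show ?thesis by (simp add: subsolutions_def L_class_def)
qed

lemma maximal_subsol_eq:
  "maximal_subsol \<delta>b \<eta>0 A U \<mu> y z = (SUP w\<in>{w \<in> subsolutions \<delta>b \<eta>0 A U \<mu>. w z = 0}. ereal (w y))"
proof -
  have "{w \<in> L_class \<delta>b \<eta>0 A U \<mu>. w z = 0 \<and> viscosity_subsol A U 0 \<mu> w} =
    {w \<in> subsolutions \<delta>b \<eta>0 A U \<mu>. w z = 0}"
    by (auto simp: subsolutions_def)
  then show ?thesis by (simp add: maximal_subsol_def)
qed

lemma le_maximal_subsol:
  assumes "w \<in> subsolutions \<delta>b \<eta>0 A U \<mu>"
  shows "ereal (w y - w z) \<le> maximal_subsol \<delta>b \<eta>0 A U \<mu> y z"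
proof -
  have "(\<lambda>y. w y - w z) \<in> {w \<in> subsolutions \<delta>b \<eta>0 A U \<mu>. w z = 0}"
    using subsolutions_diff_const[OF assms] by simp
  then show ?thesis unfolding maximal_subsol_eq by (rule SUP_upper)
qed

lemma maximal_subsol_le_chain:
  assumes "\<mu> > 0" and "closure D = UNIV" and "chain \<delta>b \<eta>0 A U D \<mu> z n t y"
  shows "maximal_subsol \<delta>b \<eta>0 A U \<mu> y z \<le> ereal t"
  unfolding maximal_subsol_eq
  using chain_bound[OF _ assms] by (intro SUP_least) fastforce

text \<open>The Hamiltonian only supplies subsolutions above level \<open>\<mu>\<close>, whereas the
  maximal subsolution belongs to \<open>\<mu>\<close> itself: multiplying by \<open>c < 1\<close>
  bridges the gap at the cost of a slightly smaller slope. Conversely, chain times dominate the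
  maximal subsolution and so inherit its growth.\<close>

lemma hamiltonian_at_le_iff_Liminf:
  assumes "\<mu> > 0" and z: "z \<in> U"
  shows "hamiltonian_at \<delta>b \<eta>0 A U p \<le> ereal \<mu> \<longleftrightarrow>
    0 \<le> Liminf (inf at_infinity (principal U))
      (\<lambda>y. (maximal_subsol \<delta>b \<eta>0 A U \<mu> y z - ereal (p \<bullet> (y - z))) / ereal (norm y))"
proof -
  have "0 \<le> maximal_subsol \<delta>b \<eta>0 A U \<mu> y z" for y
    using le_maximal_subsol[OF zero_subsolution[OF assms(1)], of y z] by (simp add: zero_ereal_def)
  note Liminf_growth_iff[OF this, of U _ p z]
  moreover have "hamiltonian_at \<delta>b \<eta>0 A U p \<le> ereal \<mu> \<longleftrightarrow>
    (\<forall>\<epsilon>>0. \<exists>C. \<forall>y\<in>U. ereal (p \<bullet> y - \<epsilon> * norm y - C) \<le> maximal_subsol \<delta>b \<eta>0 A U \<mu> y z)"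
  proof (intro iffI allI impI)
    fix \<epsilon> :: real assume H: "hamiltonian_at \<delta>b \<eta>0 A U p \<le> ereal \<mu>" and "\<epsilon> > 0"
    \<comment> \<open>\<open>c\<close> is so close to 1 that the lost slope
      \<open>(1 - c) * norm p\<close> is at most \<open>\<epsilon> / 2\<close>; the cap
      \<open>1 / 2\<close> keeps \<open>c\<close> positive.\<close>
    define c where "c = 1 - min (1 / 2) (\<epsilon> / (2 * (norm p + 1)))"
    have np: "norm p + 1 > 0" by (simp add: add_nonneg_pos)
    then have "0 < \<epsilon> / (2 * (norm p + 1))" using \<open>\<epsilon> > 0\<close> by simp
    then have c: "0 < c" "c < 1" unfolding c_def by linarith+
    have "(1 - c) * norm p \<le> \<epsilon> / (2 * (norm p + 1)) * norm p"
      unfolding c_def by (intro mult_right_mono) auto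
    also have "\<dots> \<le> \<epsilon> / 2" using np \<open>\<epsilon> > 0\<close> by (simp add: field_simps)
    finally have cp: "(1 - c) * norm p \<le> \<epsilon> / 2" .
    have "\<mu> < \<mu> / c" using c assms(1) by (simp add: field_simps)
    then obtain v where v: "v \<in> subsolutions \<delta>b \<eta>0 A U (\<mu> / c)" "growth_bound v p (\<epsilon> / 2)"
      using H \<open>\<epsilon> > 0\<close> unfolding hamiltonian_at_le_iff[OF assms(1)] by (meson half_gt_zero)
    then obtain C where C: "\<And>y. p \<bullet> y - \<epsilon> / 2 * norm y - C \<le> v y" unfolding growth_bound_def by blast
    have w: "(\<lambda>y. c * v y) \<in> subsolutions \<delta>b \<eta>0 A U \<mu>"
      using subsolutions_scale[OF v(1), of c] c by simp
    have "ereal (p \<bullet> y - \<epsilon> * norm y - (c * C + c * v z)) \<le> maximal_subsol \<delta>b \<eta>0 A U \<mu> y z" for y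
    proof -
      have "c * (p \<bullet> y - \<epsilon> / 2 * norm y - C) \<le> c * v y" using C c by (intro mult_left_mono) auto
      moreover have "(1 - c) * (p \<bullet> y) \<le> (1 - c) * (norm p * norm y)"
        using c norm_cauchy_schwarz[of p y] by (intro mult_left_mono) auto
      moreover have "(1 - c) * norm p * norm y \<le> \<epsilon> / 2 * norm y" using cp by (intro mult_right_mono) auto
      moreover have "c * (\<epsilon> / 2 * norm y) \<le> 1 * (\<epsilon> / 2 * norm y)"
        using c \<open>\<epsilon> > 0\<close> by (intro mult_right_mono) auto
      ultimately have "p \<bullet> y - \<epsilon> * norm y - (c * C + c * v z) \<le> c * v y - c * v z"
        by (simp add: algebra_simps)
      then show ?thesis using le_maximal_subsol[OF w, of y z] by (meson ereal_less_eq(3) order_trans)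
    qed
    then show "\<exists>C. \<forall>y\<in>U. ereal (p \<bullet> y - \<epsilon> * norm y - C) \<le> maximal_subsol \<delta>b \<eta>0 A U \<mu> y z" by blast
  next
    assume g: "\<forall>\<epsilon>>0. \<exists>C. \<forall>y\<in>U. ereal (p \<bullet> y - \<epsilon> * norm y - C) \<le> maximal_subsol \<delta>b \<eta>0 A U \<mu> y z"
    \<comment> \<open>With \<open>A\<close> fixed there is nothing to measure, so all points may
      serve as the dense set.\<close>
    have "chain_growth \<delta>b \<eta>0 A U UNIV \<mu> p \<epsilon> z" if \<epsilon>: "\<epsilon> > 0" for \<epsilon>
    proof -
      obtain C where C: "\<forall>y\<in>U. ereal (p \<bullet> y - \<epsilon> * norm y - C) \<le> maximal_subsol \<delta>b \<eta>0 A U \<mu> y z"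
        using g \<epsilon> by blast
      obtain N :: nat where N: "C \<le> N" using real_arch_simple by blast
      have "p \<bullet> y - \<epsilon> * norm y - N \<le> t" if ch: "chain \<delta>b \<eta>0 A U UNIV \<mu> z n t y" for n t y
      proof -
        have "ereal (p \<bullet> y - \<epsilon> * norm y - C) \<le> ereal t"
          using C chain_in_component[OF ch z] maximal_subsol_le_chain[OF assms(1) closure_UNIV ch]
          by (meson order_trans)
        then show ?thesis using N by simp
      qed
      then show ?thesis unfolding chain_growth_def by blast
    qed
    then have "\<forall>\<mu>'>\<mu>. \<forall>\<epsilon>>0. chain_growth \<delta>b \<eta>0 A U UNIV \<mu>' p \<epsilon> z"
      using chain_growth_mono less_imp_le by blast
    then show "hamiltonian_at \<delta>b \<eta>0 A U p \<le> ereal \<mu>"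
      using hamiltonian_at_le_iff_chain_growth[OF assms(1) closure_UNIV UNIV_I z] by simp
  qed
  ultimately show ?thesis by simp
qed

end

section \<open>The random medium\<close>

text \<open>Edges see positions only through distances, membership in \<open>U\<close> and values of
  \<open>A\<close>, so shifting the medium amounts to shifting the chain, with the dense set moving
  along.\<close>

lemma chain_translate:
  "chain \<delta>b \<eta>0 (\<lambda>x. A (x + h)) {x. x + h \<in> U} D \<mu> z n t y \<Longrightarrow>
   chain \<delta>b \<eta>0 A U ((+) h ` D) \<mu> (h + z) n t (h + y)"
proof (induction n arbitrary: t y)
  case (Suc n)
  then obtain x s \<kappa> where x: "x \<in> D" "s \<in> \<rat>" "\<kappa> \<in> \<rat>"
    and ch: "chain \<delta>b \<eta>0 (\<lambda>x. A (x + h)) {x. x + h \<in> U} D \<mu> z n s x"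
    and e: "edge \<delta>b \<eta>0 (\<lambda>x. A (x + h)) {x. x + h \<in> U} D \<mu> \<kappa> x y" and t: "s + \<kappa> * dist x y \<le> t"
    by auto
  have "edge \<delta>b \<eta>0 A U ((+) h ` D) \<mu> \<kappa> (h + x) (h + y)"
    using e unfolding edge_def add.commute[of _ h] by simp
  moreover have "s + \<kappa> * dist (h + x) (h + y) \<le> t" using t by simp
  ultimately show ?case using Suc.IH[OF ch] x unfolding chain.simps by blast
qed simp

lemma chain_growth_translate:
  assumes "chain_growth \<delta>b \<eta>0 A U ((+) h ` D) \<mu> p \<epsilon> (h + z)" and "0 \<le> \<epsilon>"
  shows "chain_growth \<delta>b \<eta>0 (\<lambda>x. A (x + h)) {x. x + h \<in> U} D \<mu> p \<epsilon> z"
proof -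
  obtain C :: nat where C: "\<And>y n t. y \<in> (+) h ` D \<Longrightarrow> t \<in> \<rat> \<Longrightarrow>
      chain \<delta>b \<eta>0 A U ((+) h ` D) \<mu> (h + z) n t y \<Longrightarrow> p \<bullet> y - \<epsilon> * norm y - C \<le> t"
    using assms(1) unfolding chain_growth_def by blast
  obtain N :: nat where N: "C + \<bar>p \<bullet> h\<bar> + \<epsilon> * norm h \<le> N" using real_arch_simple by blast
  have "p \<bullet> y - \<epsilon> * norm y - N \<le> t"
    if "y \<in> D" "t \<in> \<rat>" "chain \<delta>b \<eta>0 (\<lambda>x. A (x + h)) {x. x + h \<in> U} D \<mu> z n t y" for y n t
  proof -
    have "p \<bullet> (h + y) - \<epsilon> * norm (h + y) - C \<le> t"
      using C chain_translate[OF that(3)] that by blast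
    moreover have "\<epsilon> * norm (h + y) \<le> \<epsilon> * (norm h + norm y)"
      using assms(2) by (intro mult_left_mono norm_triangle_ineq)
    ultimately show ?thesis using N by (simp add: inner_add_right distrib_left)
  qed
  then show ?thesis unfolding chain_growth_def by blast
qed

text \<open>A positive rational fits strictly between two distinct nonnegative values. This reduces
  the comparison of Hamiltonians to countably many levels.\<close>

lemma ereal_eq_if_rat_le_iff:
  fixes h k :: ereal
  assumes "0 \<le> h" "0 \<le> k" and iff: "\<And>\<mu>. \<mu> \<in> \<rat> \<Longrightarrow> 0 < \<mu> \<Longrightarrow> h \<le> ereal \<mu> \<longleftrightarrow> k \<le> ereal \<mu>"
  shows "h = k"
proof -
  have "\<not> x < y" if "0 \<le> x" "\<And>\<mu>. \<mu> \<in> \<rat> \<Longrightarrow> 0 < \<mu> \<Longrightarrow> x \<le> ereal \<mu> \<Longrightarrow> y \<le> ereal \<mu>" for x y :: ereal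
  proof
    assume "x < y"
    then obtain r where r: "x < ereal (real_of_rat r)" "ereal (real_of_rat r) < y" using ereal_dense3 by blast
    have "0 < ereal (real_of_rat r)" using that(1) r(1) by (rule le_less_trans)
    then have "y \<le> ereal (real_of_rat r)" using that(2)[OF Rats_of_rat _ less_imp_le[OF r(1)]] by simp
    then show False using r(2) by simp
  qed
  from this[of h k] this[of k h] show ?thesis using assms by (meson linorder_cases)
qed

section \<open>Measurability of chains\<close>

locale random_component = prob_space M
  for M :: "'w measure" +
  fixes \<tau> :: "real ^ 'n \<Rightarrow> 'w \<Rightarrow> 'w" and a :: "real ^ 'n \<Rightarrow> 'w \<Rightarrow> real" and V :: "'w set"
    and \<delta>b :: "real \<Rightarrow> real" and \<eta>0 :: real
  assumes flow: "ergodic_flow M \<tau>" and coefficient: "random_coefficient M a"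
    and stationary: "stationary_coefficient M \<tau> a" and V: "V \<in> sets M"
    and component: "\<And>\<omega>. \<omega> \<in> space M \<Longrightarrow> region \<tau> V \<omega> \<in> components {x. a x \<omega> > 0}"
    and threshold: "admissible_threshold \<delta>b \<eta>0"
begin

abbreviation "A \<omega> \<equiv> (\<lambda>x. a x \<omega>)"
abbreviation "U \<equiv> region \<tau> V"

lemma realisation: "\<omega> \<in> space M \<Longrightarrow> positive_component (A \<omega>) (U \<omega>) \<delta>b \<eta>0"
  using coefficient component threshold
  by unfold_locales (auto simp: random_coefficient_def)

lemma flow_space: "\<omega> \<in> space M \<Longrightarrow> \<tau> h \<omega> \<in> space M"
  using flow by (auto simp: ergodic_flow_def)

lemma flow_inverse: "\<omega> \<in> space M \<Longrightarrow> \<tau> h (\<tau> (- h) \<omega>) = \<omega>"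
  using flow unfolding ergodic_flow_def by (metis add.right_inverse)

text \<open>\<open>ergodic_flow\<close> speaks of images; invertibility turns the preimages that
  measurability concerns into such images.\<close>

lemma flow_image:
  assumes "W \<subseteq> space M"
  shows "\<tau> (- h) ` W = {\<omega> \<in> space M. \<tau> h \<omega> \<in> W}"
proof (intro set_eqI iffI)
  fix \<omega> assume "\<omega> \<in> {\<omega> \<in> space M. \<tau> h \<omega> \<in> W}"
  then have "\<omega> = \<tau> (- h) (\<tau> h \<omega>)" "\<tau> h \<omega> \<in> W" using flow_inverse[of \<omega> "- h"] by auto
  then show "\<omega> \<in> \<tau> (- h) ` W" by blast
qed (use assms flow_inverse flow_space in auto)

lemma in_region_measurable: "Measurable.pred M (\<lambda>\<omega>. x \<in> U \<omega>)"
proof -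
  have "\<tau> (- x) ` V \<in> sets M" using flow V by (auto simp: ergodic_flow_def)
  then show ?thesis
    using flow_image[OF sets.sets_into_space[OF V], of x] by (simp add: pred_def region_def)
qed

lemma coefficient_measurable: "a x \<in> borel_measurable M"
proof -
  have "(\<lambda>(y, \<omega>). a y \<omega>) \<in> borel_measurable (borel \<Otimes>\<^sub>M M)"
    using coefficient by (simp add: random_coefficient_def)
  from measurable_Pair2[OF this, of x] show ?thesis by simp
qed

lemma edge_measurable:
  assumes "countable D"
  shows "Measurable.pred M (\<lambda>\<omega>. edge \<delta>b \<eta>0 (A \<omega>) (U \<omega>) D \<mu> \<kappa> x y)"
proof -
  \<comment> \<open>The jump alternative quantifies over uncountably many \<open>\<eta>\<close> and
    \<open>\<delta>\<close> with an arbitrary function \<open>\<delta>b\<close>. It depends on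
    \<open>\<omega>\<close> only through the smaller of two values of \<open>a\<close>, and
    \<open>J\<close> is open as a union of open half-lines.\<close>
  define J where "J = (\<Union>\<eta>. \<Union>\<delta>\<in>{\<delta>. 0 < \<eta> \<and> \<eta> < \<eta>0 \<and> 0 < \<delta> \<and> \<delta> < \<delta>b \<eta> \<and> \<mu> / \<delta> + \<eta> \<le> \<kappa>}. {\<delta><..})"
  have "open J" unfolding J_def by (intro open_UN ballI open_greaterThan)
  then have J: "J \<in> sets borel" by simp
  have min: "(\<lambda>\<omega>. min (a x \<omega>) (a y \<omega>)) \<in> borel_measurable M"
    using coefficient_measurable by (intro borel_measurable_min)
  have "Measurable.pred M (\<lambda>\<omega>. min (a x \<omega>) (a y \<omega>) \<in> J)"
    using measurable_sets[OF min J] by (simp add: pred_def vimage_def Int_def conj_commute)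
  moreover have "(\<exists>\<eta> \<delta>. 0 < \<eta> \<and> \<eta> < \<eta>0 \<and> 0 < \<delta> \<and> \<delta> < \<delta>b \<eta> \<and> \<delta> < a x \<omega> \<and> \<delta> < a y \<omega> \<and> \<mu> / \<delta> + \<eta> \<le> \<kappa>) \<longleftrightarrow>
    min (a x \<omega>) (a y \<omega>) \<in> J" for \<omega>
    by (auto simp: J_def)
  ultimately have jump: "Measurable.pred M (\<lambda>\<omega>. \<exists>\<eta> \<delta>. 0 < \<eta> \<and> \<eta> < \<eta>0 \<and> 0 < \<delta> \<and> \<delta> < \<delta>b \<eta> \<and>
      \<delta> < a x \<omega> \<and> \<delta> < a y \<omega> \<and> \<mu> / \<delta> + \<eta> \<le> \<kappa>)" by simp
  have "Measurable.pred M (\<lambda>\<omega>. 0 < a u \<omega> \<and> \<mu> \<le> \<kappa> * a u \<omega>)" for u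
    using coefficient_measurable[of u] by measurable
  then have near: "Measurable.pred M (\<lambda>\<omega>. \<forall>u\<in>D. dist x u < 2 * dist x y \<longrightarrow> 0 < a u \<omega> \<and> \<mu> \<le> \<kappa> * a u \<omega>)"
    using assms by (intro measurable_pred_countable pred_intros_imp')
  show ?thesis
    unfolding edge_def
    by (intro pred_intros_logic in_region_measurable jump near)
qed

lemma chain_measurable:
  assumes "countable D"
  shows "Measurable.pred M (\<lambda>\<omega>. chain \<delta>b \<eta>0 (A \<omega>) (U \<omega>) D \<mu> z n t y)"
proof (induction n arbitrary: t y)
  case (Suc n)
  then show ?case
    unfolding chain.simps
    by (intro measurable_pred_countable pred_intros_logic assms countable_rat edge_measurable) auto
qed auto

lemma chain_growth_measurable:
  assumes "countable D"
  shows "Measurable.pred M (\<lambda>\<omega>. chain_growth \<delta>b \<eta>0 (A \<omega>) (U \<omega>) D \<mu> p \<epsilon> z)"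
  unfolding chain_growth_def
  by (intro pred_intros_countable measurable_pred_countable pred_intros_logic assms countable_rat
      chain_measurable) auto

section \<open>Growth events and the zero-one law\<close>

text \<open>The levels \<open>\<mu>' > \<mu>\<close> leave room for the loss in
  \<open>subsolution_from_chains\<close>; start points in \<open>D\<close> and rational levels keep
  the quantifiers countable for countable \<open>D\<close>.\<close>

definition growth_event :: "(real ^ 'n) set \<Rightarrow> real \<Rightarrow> real ^ 'n \<Rightarrow> real \<Rightarrow> 'w set" where
  "growth_event D \<mu> q \<epsilon> = {\<omega> \<in> space M. \<forall>z\<in>D. z \<in> U \<omega> \<longrightarrow>
     (\<forall>\<mu>'\<in>\<rat>. \<mu> < \<mu>' \<longrightarrow> chain_growth \<delta>b \<eta>0 (A \<omega>) (U \<omega>) D \<mu>' q \<epsilon> z)}"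

lemma growth_event_sets:
  assumes "countable D"
  shows "growth_event D \<mu> q \<epsilon> \<in> sets M"
proof -
  have "Measurable.pred M (\<lambda>\<omega>. \<forall>z\<in>D. z \<in> U \<omega> \<longrightarrow>
     (\<forall>\<mu>'\<in>\<rat>. \<mu> < \<mu>' \<longrightarrow> chain_growth \<delta>b \<eta>0 (A \<omega>) (U \<omega>) D \<mu>' q \<epsilon> z))"
    by (intro measurable_pred_countable pred_intros_logic pred_intros_imp' assms countable_rat
        in_region_measurable chain_growth_measurable)
  then show ?thesis unfolding growth_event_def pred_def .
qed

lemma dense_meets_region:
  assumes "closure D = UNIV" "\<omega> \<in> space M"
  obtains z where "z \<in> D" "z \<in> U \<omega>"
proof -
  interpret positive_component "A \<omega>" "U \<omega>" \<delta>b \<eta>0 using realisation assms(2) .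
  have "U \<omega> \<inter> D \<noteq> {}"
    using open_Int_closure_eq_empty[OF open_U, of D] U_nonempty assms(1) by simp
  then show ?thesis using that by blast
qed

text \<open>Translating \<open>\<omega>\<close> replaces \<open>D\<close> by a translate. The proof
  passes from chains to a subsolution, which does not see the dense set, and back to chains over the
  translate, at an arbitrarily small loss in level.\<close>

lemma growth_event_flow:
  assumes dense: "closure D = UNIV" and "0 < \<mu>" "0 < \<epsilon>" and \<omega>: "\<omega> \<in> growth_event D \<mu> q \<epsilon>"
  shows "\<tau> h \<omega> \<in> growth_event D \<mu> q \<epsilon>"
proof -
  have sp: "\<omega> \<in> space M" using \<omega> by (simp add: growth_event_def)
  interpret positive_component "A \<omega>" "U \<omega>" \<delta>b \<eta>0 using realisation sp .
  have A': "A (\<tau> h \<omega>) = (\<lambda>x. a (x + h) \<omega>)"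
    using stationary sp by (simp add: stationary_coefficient_def)
  have U': "U (\<tau> h \<omega>) = {x. x + h \<in> U \<omega>}"
    using flow sp by (simp add: ergodic_flow_def region_def)
  obtain z0 where z0: "z0 \<in> D" "z0 \<in> U \<omega>" using dense_meets_region[OF dense sp] .
  have dense': "closure ((+) h ` D) = UNIV" by (simp add: closure_translation dense)
  have "chain_growth \<delta>b \<eta>0 (A (\<tau> h \<omega>)) (U (\<tau> h \<omega>)) D \<mu>' q \<epsilon> z" if \<mu>': "\<mu> < \<mu>'" for \<mu>' z
  proof -
    obtain \<nu> where \<nu>: "\<nu> \<in> \<rat>" "\<mu> < \<nu>" "\<nu> < \<mu>'" using Rats_dense_in_real[OF \<mu>'] by blast
    have "chain_growth \<delta>b \<eta>0 (A \<omega>) (U \<omega>) D \<nu> q \<epsilon> z0"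
      using \<omega> z0 \<nu> by (simp add: growth_event_def)
    moreover have "0 < \<nu>" using \<nu> \<open>0 < \<mu>\<close> by linarith
    ultimately obtain v where "v \<in> subsolutions \<delta>b \<eta>0 (A \<omega>) (U \<omega>) \<mu>'" "growth_bound v q \<epsilon>"
      using subsolution_from_chains[OF dense z0 _ \<nu>(3) \<open>0 < \<epsilon>\<close>, of q] \<open>0 < \<epsilon>\<close> by fastforce
    then have "chain_growth \<delta>b \<eta>0 (A \<omega>) (U \<omega>) ((+) h ` D) \<mu>' q \<epsilon> (h + z)"
      using dense' \<mu>' \<open>0 < \<mu>\<close> by (intro chain_growth_if_growth_bound) auto
    then show ?thesis unfolding A' U' using \<open>0 < \<epsilon>\<close> by (intro chain_growth_translate) auto
  qed
  then show ?thesis using flow_space[OF sp] unfolding growth_event_def by blast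
qed

text \<open>The event is exactly invariant, so ergodicity makes its probability 0 or 1, and
  membership is almost surely a deterministic truth value.\<close>

lemma growth_event_trivial:
  assumes "countable D" "closure D = UNIV" "0 < \<mu>" "0 < \<epsilon>"
  shows "AE \<omega> in M. \<omega> \<in> growth_event D \<mu> q \<epsilon> \<longleftrightarrow> prob (growth_event D \<mu> q \<epsilon>) = 1"
proof -
  let ?B = "growth_event D \<mu> q \<epsilon>"
  have B: "?B \<in> sets M" using growth_event_sets assms(1) .
  have "\<tau> h ` ?B = ?B" for h
  proof
    show "\<tau> h ` ?B \<subseteq> ?B" using growth_event_flow[OF assms(2-4)] by blast
    show "?B \<subseteq> \<tau> h ` ?B"
    proof
      fix \<omega> assume \<omega>: "\<omega> \<in> ?B"
      then have "\<tau> (- h) \<omega> \<in> ?B" using growth_event_flow[OF assms(2-4)] by blast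
      moreover have "\<omega> = \<tau> h (\<tau> (- h) \<omega>)" using \<omega> flow_inverse by (simp add: growth_event_def)
      ultimately show "\<omega> \<in> \<tau> h ` ?B" by blast
    qed
  qed
  then have "prob ?B \<in> {0, 1}" using flow B by (simp add: ergodic_flow_def)
  then consider "prob ?B = 0" | "prob ?B = 1" by blast
  then show ?thesis
  proof cases
    case 1
    then have "AE \<omega> in M. \<omega> \<notin> ?B"
      using B by (intro AE_not_in) (simp add: null_sets_def emeasure_eq_measure)
    then show ?thesis using 1 by simp
  next
    case 2
    then show ?thesis using AE_prob_1[OF 2] by simp
  qed
qed

section \<open>Almost sure constancy of the Hamiltonian\<close>

text \<open>A slope \<open>q\<close> in \<open>D\<close> replaces \<open>p\<close> at the price of
  an error slope \<open>norm (p - q)\<close>, so the events indexed by \<open>D\<close> and rational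
  \<open>\<epsilon>\<close> decide the inequality for every \<open>p\<close>.\<close>

lemma hamiltonian_at_le_iff_growth_event:
  assumes dense: "closure D = UNIV" and "\<mu> > 0" and \<omega>: "\<omega> \<in> space M"
  shows "hamiltonian_at \<delta>b \<eta>0 (A \<omega>) (U \<omega>) p \<le> ereal \<mu> \<longleftrightarrow>
    (\<forall>q\<in>D. \<forall>\<epsilon>\<in>\<rat>. norm (p - q) < \<epsilon> \<longrightarrow> \<omega> \<in> growth_event D \<mu> q \<epsilon>)"
proof -
  interpret positive_component "A \<omega>" "U \<omega>" \<delta>b \<eta>0 using realisation \<omega> .
  show ?thesis
  proof (intro iffI ballI impI)
    fix q \<epsilon> assume H: "hamiltonian_at \<delta>b \<eta>0 (A \<omega>) (U \<omega>) p \<le> ereal \<mu>" and \<epsilon>: "norm (p - q) < \<epsilon>"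
    have "chain_growth \<delta>b \<eta>0 (A \<omega>) (U \<omega>) D \<mu>' q \<epsilon> z" if "z \<in> D" "z \<in> U \<omega>" "\<mu> < \<mu>'" for \<mu>' z
    proof (rule chain_growth_perturb)
      show "chain_growth \<delta>b \<eta>0 (A \<omega>) (U \<omega>) D \<mu>' p (\<epsilon> - norm (p - q)) z"
        using H \<epsilon> hamiltonian_at_le_iff_chain_growth[OF \<open>\<mu> > 0\<close> dense that(1,2)] that(3) by simp
      show "norm (q - p) + (\<epsilon> - norm (p - q)) \<le> \<epsilon>" by (simp add: norm_minus_commute)
    qed
    then show "\<omega> \<in> growth_event D \<mu> q \<epsilon>" using \<omega> by (simp add: growth_event_def)
  next
    assume B: "\<forall>q\<in>D. \<forall>\<epsilon>\<in>\<rat>. norm (p - q) < \<epsilon> \<longrightarrow> \<omega> \<in> growth_event D \<mu> q \<epsilon>"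
    obtain z where z: "z \<in> D" "z \<in> U \<omega>" using dense_meets_region[OF dense \<omega>] .
    have "chain_growth \<delta>b \<eta>0 (A \<omega>) (U \<omega>) D \<mu>' p e z" if \<mu>': "\<mu> < \<mu>'" and e: "e > 0" for \<mu>' e
    proof -
      obtain \<nu> where \<nu>: "\<nu> \<in> \<rat>" "\<mu> < \<nu>" "\<nu> < \<mu>'" using Rats_dense_in_real[OF \<open>\<mu> < \<mu>'\<close>] by blast
      \<comment> \<open>One half of \<open>e\<close> is for the error slope, the other for the
        distance from \<open>q\<close> to \<open>p\<close>.\<close>
      have "0 < e / 2" using \<open>e > 0\<close> by simp
      then obtain \<epsilon> where \<epsilon>: "\<epsilon> \<in> \<rat>" "0 < \<epsilon>" "\<epsilon> < e / 2" using Rats_dense_in_real by blast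
      have "p \<in> closure D" using dense by simp
      then obtain q where q: "q \<in> D" "dist q p < \<epsilon>" using \<epsilon>(2) closure_approachable by blast
      then have pq: "norm (p - q) < \<epsilon>" by (simp add: dist_norm norm_minus_commute)
      then have "\<omega> \<in> growth_event D \<mu> q \<epsilon>" using B q \<epsilon> by blast
      then have "chain_growth \<delta>b \<eta>0 (A \<omega>) (U \<omega>) D \<nu> q \<epsilon> z"
        using z \<nu> by (simp add: growth_event_def)
      then have "chain_growth \<delta>b \<eta>0 (A \<omega>) (U \<omega>) D \<mu>' q \<epsilon> z"
        by (rule chain_growth_mono[OF _ less_imp_le[OF \<nu>(3)]])
      then show ?thesis by (rule chain_growth_perturb) (use pq \<epsilon>(3) in linarith)
    qed
    then show "hamiltonian_at \<delta>b \<eta>0 (A \<omega>) (U \<omega>) p \<le> ereal \<mu>"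
      using hamiltonian_at_le_iff_chain_growth[OF \<open>\<mu> > 0\<close> dense z] by blast
  qed
qed

text \<open>
  The growth events of rational data determine the Hamiltonian at all \<open>p\<close> at once.  Countably many
  \<open>p\<close> would not suffice, as the Hamiltonian may be infinite off a set with empty interior.
\<close>

theorem effective_hamiltonian_eq:
  "AE \<omega> in M. \<forall>p. hamiltonian_at \<delta>b \<eta>0 (A \<omega>) (U \<omega>) p = effective_hamiltonian \<delta>b \<eta>0 M \<tau> a V p"
proof -
  obtain D :: "(real ^ 'n) set" where D: "countable D" "\<And>X. open X \<Longrightarrow> X \<noteq> {} \<Longrightarrow> \<exists>d\<in>D. d \<in> X"
    by (rule countable_dense_setE) blast
  have dense: "closure D = UNIV"
    using D(2)[of "- closure D"] closure_subset[of D] by fastforce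
  \<comment> \<open>The data are countable, hence a single null set serves all
    \<open>p\<close>.\<close>
  define good where "good = (\<lambda>\<omega>. \<forall>q\<in>D. \<forall>\<mu>\<in>\<rat>. \<forall>\<epsilon>\<in>\<rat>. 0 < \<mu> \<longrightarrow> 0 < \<epsilon> \<longrightarrow>
    (\<omega> \<in> growth_event D \<mu> q \<epsilon> \<longleftrightarrow> prob (growth_event D \<mu> q \<epsilon>) = 1))"
  have good: "AE \<omega> in M. good \<omega>"
    unfolding good_def
  proof (intro AE_ball_countable[OF D(1), THEN iffD2] AE_ball_countable[OF countable_rat, THEN iffD2] ballI)
    fix q and \<mu> \<epsilon> :: real
    show "AE \<omega> in M. 0 < \<mu> \<longrightarrow> 0 < \<epsilon> \<longrightarrow>
        (\<omega> \<in> growth_event D \<mu> q \<epsilon> \<longleftrightarrow> prob (growth_event D \<mu> q \<epsilon>) = 1)"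
      using growth_event_trivial[OF D(1) dense, of \<mu> \<epsilon> q] by (cases "0 < \<mu> \<and> 0 < \<epsilon>") auto
  qed
  have eq: "hamiltonian_at \<delta>b \<eta>0 (A \<omega>) (U \<omega>) p = hamiltonian_at \<delta>b \<eta>0 (A \<omega>') (U \<omega>') p"
    if "good \<omega>" "good \<omega>'" and \<omega>: "\<omega> \<in> space M" "\<omega>' \<in> space M" for \<omega> \<omega>' p
  proof (rule ereal_eq_if_rat_le_iff)
    show "0 \<le> hamiltonian_at \<delta>b \<eta>0 (A \<omega>) (U \<omega>) p" "0 \<le> hamiltonian_at \<delta>b \<eta>0 (A \<omega>') (U \<omega>') p"
      using positive_component.hamiltonian_at_nonneg realisation \<omega> by blast+
    fix \<mu> :: real assume \<mu>: "\<mu> \<in> \<rat>" "0 < \<mu>"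
    have "\<omega> \<in> growth_event D \<mu> q \<epsilon> \<longleftrightarrow> \<omega>' \<in> growth_event D \<mu> q \<epsilon>"
      if "q \<in> D" "\<epsilon> \<in> \<rat>" "norm (p - q) < \<epsilon>" for q \<epsilon>
    proof -
      have "0 < \<epsilon>" using that(3) norm_ge_zero[of "p - q"] by linarith
      then show ?thesis using \<open>good \<omega>\<close> \<open>good \<omega>'\<close> \<mu> that unfolding good_def by blast
    qed
    then show "hamiltonian_at \<delta>b \<eta>0 (A \<omega>) (U \<omega>) p \<le> ereal \<mu> \<longleftrightarrow>
        hamiltonian_at \<delta>b \<eta>0 (A \<omega>') (U \<omega>') p \<le> ereal \<mu>"
      unfolding hamiltonian_at_le_iff_growth_event[OF dense \<mu>(2) \<omega>(1)]
        hamiltonian_at_le_iff_growth_event[OF dense \<mu>(2) \<omega>(2)] by blast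
  qed
  \<comment> \<open>A fixed good realisation supplies the constant. Two almost sure values coincide,
    so the definite description in \<open>effective_hamiltonian\<close> picks it.\<close>
  obtain \<omega>0 where \<omega>0: "good \<omega>0" "\<omega>0 \<in> space M" using AE_contr[OF good] by blast
  have AE_eq: "AE \<omega> in M. hamiltonian_at \<delta>b \<eta>0 (A \<omega>) (U \<omega>) p = hamiltonian_at \<delta>b \<eta>0 (A \<omega>0) (U \<omega>0) p" for p
    using good AE_space by eventually_elim (rule eq[OF _ \<omega>0(1) _ \<omega>0(2)])
  have effective: "effective_hamiltonian \<delta>b \<eta>0 M \<tau> a V p = hamiltonian_at \<delta>b \<eta>0 (A \<omega>0) (U \<omega>0) p" for p
    unfolding effective_hamiltonian_def
  proof (rule the_equality[where P = "\<lambda>h. AE \<omega> in M. hamiltonian_at \<delta>b \<eta>0 (A \<omega>) (U \<omega>) p = h", OF AE_eq])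
    fix h assume "AE \<omega> in M. hamiltonian_at \<delta>b \<eta>0 (A \<omega>) (U \<omega>) p = h"
    with AE_eq[of p] have "AE \<omega> in M. h = hamiltonian_at \<delta>b \<eta>0 (A \<omega>0) (U \<omega>0) p" by eventually_elim simp
    then show "h = hamiltonian_at \<delta>b \<eta>0 (A \<omega>0) (U \<omega>0) p" by simp
  qed
  show ?thesis
    using good AE_space
  proof eventually_elim
    case (elim \<omega>)
    show ?case
      unfolding effective using eq[OF elim(1) \<omega>0(1) elim(2) \<omega>0(2)] by blast
  qed
qed

end

theorem proposition4:
  fixes M :: "'w measure"
    and \<tau> :: "real ^ 'n \<Rightarrow> 'w \<Rightarrow> 'w"
    and a :: "real ^ 'n \<Rightarrow> 'w \<Rightarrow> real"
    and Ipos Ineg :: "'i set" and V :: "'i \<Rightarrow> 'w set" and V0 :: "'w set" and i :: 'i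
    and \<delta>b :: "real \<Rightarrow> real" and \<eta>0 :: real
  assumes "prob_space M"
    and "ergodic_flow M \<tau>"
    and "random_coefficient M a"
    and A1: "stationary_coefficient M \<tau> a"
    and S1: "stationary_components M \<tau> a Ipos Ineg V V0"
    and "i \<in> Ipos"
    and "\<forall>\<omega>\<in>space M. \<not> bounded (region \<tau> (V i) \<omega>)"
    and "admissible_threshold \<delta>b \<eta>0"
  shows "AE \<omega> in M. \<forall>p. \<forall>\<mu>>0. \<forall>z\<in>region \<tau> (V i) \<omega>.
           ereal \<mu> \<ge> effective_hamiltonian \<delta>b \<eta>0 M \<tau> a (V i) p \<longleftrightarrow>
           Liminf (inf at_infinity (principal (region \<tau> (V i) \<omega>)))
             (\<lambda>y. (maximal_subsol \<delta>b \<eta>0 (\<lambda>x. a x \<omega>) (region \<tau> (V i) \<omega>) \<mu> y z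
                    - ereal (p \<bullet> (y - z))) / ereal (norm y)) \<ge> 0"
proof -
  interpret random_component M \<tau> a "V i" \<delta>b \<eta>0
  proof (intro random_component.intro random_component_axioms.intro)
    fix \<omega> assume "\<omega> \<in> space M"
    then show "region \<tau> (V i) \<omega> \<in> components {x. a x \<omega> > 0}"
      using S1 \<open>i \<in> Ipos\<close> unfolding stationary_components_def bij_betw_def by blast
  next
    show "V i \<in> sets M" using S1 \<open>i \<in> Ipos\<close> unfolding stationary_components_def by blast
  qed (use assms in auto)
  \<comment> \<open>The only exceptional null set is that of
    \<open>effective_hamiltonian_eq\<close>; off it, the equivalence for a single realisation covers
    every \<open>p\<close>, \<open>\<mu>\<close> and \<open>z\<close>.\<close>
  show ?thesis
    using effective_hamiltonian_eq AE_space
  proof eventually_elim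
    case (elim \<omega>)
    then have "hamiltonian_at \<delta>b \<eta>0 (\<lambda>x. a x \<omega>) (region \<tau> (V i) \<omega>) p =
        effective_hamiltonian \<delta>b \<eta>0 M \<tau> a (V i) p" for p by simp
    note this[symmetric]
    then show ?case
      using positive_component.hamiltonian_at_le_iff_Liminf[OF realisation[OF elim(2)]] by simp
  qed
qed

end
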